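(* Let $X$ be a finite alphabet and let $H=\mathrm{Gp}\langle X\mid R\rangle$ be a finitely presented group which is free, with a free basis $U_H\subset\overline{X}^{\ast}$. Let $A,B\le H$ be subgroups, $\phi:A\to B$ an isomorphism, and $H^\ast = H\ast_{t,\phi:A\to B}$ the corresponding HNN extension. Suppose that there are $U_A,U_B\subset\overline{U_H}$ such that $A=\mathrm{Gp}\langle U_A\rangle$, $B=\mathrm{Gp}\langle U_B\rangle$ and $\phi(\overline{U_A})=\overline{U_B}$. Let $Q$ be a submonoid of $H$ generated by some $U_Q\subseteq\overline{U_H}$. If $\phi(Q\cap A)=Q\cap B$, then membership in the submonoid $P=\mathrm{Mon}\langle Q\cup\{t,t^{-1}\}\rangle$ of $H^\ast$ is decidable.
   Context: For a set $Y$ of letters (or of words/elements), $\overline{Y}=Y\cup Y^{-1}$, and $\overline{Y}^{\ast}$ is the set of all finite words over $\overline{Y}$. $\mathrm{Gp}\langle S\rangle$ and $\mathrm{Mon}\langle S\rangle$ denote the subgroup and the submonoid generated by $S$. A set of words is a free basis of $H$ if the elements it represents freely generate $H$ (distinct words representing distinct basis elements). The HNN extension $H\ast_{t,\phi:A\to B}$ is the group generated by $X\cup\{t\}$ subject to the relations $R$ of $H$ together with $t^{-1}at=\phi(a)$ for all $a\in A$. "Membership in $P$ within $H^\ast$ is decidable" means that there is an algorithm which, given as input a word $w\in(\overline{X}\cup\{t,t^{-1}\})^{\ast}$, decides whether the element of $H^\ast$ represented by $w$ lies in $P$. *)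

theory Defs
  imports "HOL-Algebra.Generated_Groups" "HOL-Library.Nat_Bijection"
begin

section \<open>Words over an alphabet with formal inverses\<close>

text \<open>The letter \<open>(x, True)\<close> stands for \<open>x\<close> and \<open>(x, False)\<close> for the formal inverse of \<open>x\<close>.\<close>

type_synonym 'x letter = "'x \<times> bool"
type_synonym 'x word = "'x letter list"

definition inv_letter :: "'x letter \<Rightarrow> 'x letter" where
  "inv_letter l = (fst l, \<not> snd l)"

definition inv_word :: "'x word \<Rightarrow> 'x word" where
  "inv_word w = rev (map inv_letter w)"

definition letters :: "'x set \<Rightarrow> 'x letter set" where
  "letters X = X \<times> UNIV"

abbreviation words :: "'x set \<Rightarrow> 'x word set" where
  "words X \<equiv> lists (letters X)"

definition bar :: "'x word set \<Rightarrow> 'x word set" where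
  "bar U = U \<union> inv_word ` U"

definition reduced :: "'x word \<Rightarrow> bool" where
  "reduced w \<longleftrightarrow> successively (\<lambda>k l. l \<noteq> inv_letter k) w"


section \<open>Group presentations\<close>

text \<open>A defining relation \<open>u = v\<close> is the pair \<open>(u, v)\<close>; a relator \<open>r\<close> is the pair \<open>(r, [])\<close>.\<close>

inductive gp_eq :: "'x set \<Rightarrow> ('x word \<times> 'x word) set \<Rightarrow> 'x word \<Rightarrow> 'x word \<Rightarrow> bool"
  for X :: "'x set" and R :: "('x word \<times> 'x word) set" where
  rel: "(u, v) \<in> R \<Longrightarrow> u \<in> words X \<Longrightarrow> v \<in> words X \<Longrightarrow> gp_eq X R u v"
| cancel: "l \<in> letters X \<Longrightarrow> gp_eq X R [l, inv_letter l] []"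
| refl: "u \<in> words X \<Longrightarrow> gp_eq X R u u"
| sym: "gp_eq X R u v \<Longrightarrow> gp_eq X R v u"
| trans: "gp_eq X R u v \<Longrightarrow> gp_eq X R v w \<Longrightarrow> gp_eq X R u w"
| append: "gp_eq X R u v \<Longrightarrow> gp_eq X R u' v' \<Longrightarrow> gp_eq X R (u @ u') (v @ v')"

definition gp_class :: "'x set \<Rightarrow> ('x word \<times> 'x word) set \<Rightarrow> 'x word \<Rightarrow> 'x word set" where
  "gp_class X R w = {v. gp_eq X R w v}"

definition Gp :: "'x set \<Rightarrow> ('x word \<times> 'x word) set \<Rightarrow> 'x word set monoid" where
  "Gp X R = \<lparr> carrier = gp_class X R ` words X,
              monoid.mult = (\<lambda>C D. \<Union>u\<in>C. \<Union>v\<in>D. gp_class X R (u @ v)),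
              one = gp_class X R [] \<rparr>"

lemma gp_eq_words: "gp_eq X R u v \<Longrightarrow> u \<in> words X \<and> v \<in> words X"
  by (induction rule: gp_eq.induct) (auto simp: letters_def inv_letter_def)

lemma gp_class_eq_iff:
  "u \<in> words X \<Longrightarrow> gp_class X R u = gp_class X R v \<longleftrightarrow> gp_eq X R u v"
  unfolding gp_class_def by (metis (no_types, lifting) Collect_cong gp_eq.refl gp_eq.sym gp_eq.trans mem_Collect_eq)

lemma gp_mult_class:
  assumes "u \<in> words X" "v \<in> words X"
  shows "gp_class X R u \<otimes>\<^bsub>Gp X R\<^esub> gp_class X R v = gp_class X R (u @ v)"
proof -
  have *: "gp_class X R (u' @ v') = gp_class X R (u @ v)"
    if "u' \<in> gp_class X R u" "v' \<in> gp_class X R v" for u' v'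
  proof -
    have "gp_eq X R (u @ v) (u' @ v')"
      using that by (intro gp_eq.append) (simp_all add: gp_class_def)
    moreover have "u @ v \<in> words X" using assms by simp
    ultimately show ?thesis using gp_class_eq_iff by metis
  qed
  have "u \<in> gp_class X R u" "v \<in> gp_class X R v"
    using assms by (simp_all add: gp_class_def gp_eq.refl)
  then have "(\<Union>u'\<in>gp_class X R u. \<Union>v'\<in>gp_class X R v. gp_class X R (u' @ v')) = gp_class X R (u @ v)"
    using * by blast
  then show ?thesis by (simp add: Gp_def)
qed

lemma inv_word_words: "w \<in> words X \<Longrightarrow> inv_word w \<in> words X"
  by (induction w) (auto simp: letters_def inv_word_def inv_letter_def)

lemma inv_word_cancel: "w \<in> words X \<Longrightarrow> gp_eq X R (inv_word w @ w) []"
proof (induction w)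
  case Nil
  show ?case by (simp add: inv_word_def gp_eq.refl)
next
  case (Cons l w)
  have l: "l \<in> letters X" and w: "w \<in> words X" using Cons.prems by auto
  have il: "inv_letter l \<in> letters X" "inv_letter (inv_letter l) = l"
    using l by (auto simp: letters_def inv_letter_def)
  have "gp_eq X R [inv_letter l, l] []" using gp_eq.cancel[OF il(1)] il(2) by simp
  moreover have iw: "inv_word w \<in> words X"
    using w by (rule inv_word_words)
  ultimately have "gp_eq X R (inv_word w @ ([inv_letter l, l] @ w)) (inv_word w @ ([] @ w))"
    using w by (intro gp_eq.append gp_eq.refl)
  moreover have "gp_eq X R (inv_word w @ w) []" using Cons.IH w by simp
  ultimately show ?case by (auto simp: inv_word_def intro: gp_eq.trans)
qed

lemma group_Gp: "group (Gp X R)"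
proof (rule groupI)
  have car: "carrier (Gp X R) = gp_class X R ` words X" and one: "\<one>\<^bsub>Gp X R\<^esub> = gp_class X R []"
    by (simp_all add: Gp_def)
  show "\<one>\<^bsub>Gp X R\<^esub> \<in> carrier (Gp X R)" by (auto simp: car one)
  fix C assume C: "C \<in> carrier (Gp X R)"
  then obtain u where u: "u \<in> words X" "C = gp_class X R u" by (auto simp: car)
  show "\<one>\<^bsub>Gp X R\<^esub> \<otimes>\<^bsub>Gp X R\<^esub> C = C" using u gp_mult_class[of "[]" X u R] by (simp add: one)
  have iu: "inv_word u \<in> words X"
    using u(1) by (rule inv_word_words)
  have "gp_class X R (inv_word u) \<otimes>\<^bsub>Gp X R\<^esub> C = \<one>\<^bsub>Gp X R\<^esub>"
    using u iu by (simp add: one gp_mult_class gp_class_eq_iff inv_word_cancel)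
  then show "\<exists>D\<in>carrier (Gp X R). D \<otimes>\<^bsub>Gp X R\<^esub> C = \<one>\<^bsub>Gp X R\<^esub>" using iu by (auto simp: car)
  fix D assume D: "D \<in> carrier (Gp X R)"
  then obtain v where v: "v \<in> words X" "D = gp_class X R v" by (auto simp: car)
  show "C \<otimes>\<^bsub>Gp X R\<^esub> D \<in> carrier (Gp X R)" using u v by (auto simp: gp_mult_class car)
  fix E assume E: "E \<in> carrier (Gp X R)"
  then obtain w where w: "w \<in> words X" "E = gp_class X R w" by (auto simp: car)
  show "C \<otimes>\<^bsub>Gp X R\<^esub> D \<otimes>\<^bsub>Gp X R\<^esub> E = C \<otimes>\<^bsub>Gp X R\<^esub> (D \<otimes>\<^bsub>Gp X R\<^esub> E)"
    using u v w by (simp add: gp_mult_class)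
qed


section \<open>Free bases and generated submonoids\<close>

definition word_value :: "('g, 'b) monoid_scheme \<Rightarrow> 'g word \<Rightarrow> 'g" where
  "word_value G w = foldr (\<lambda>(g, b) h. (if b then g else inv\<^bsub>G\<^esub> g) \<otimes>\<^bsub>G\<^esub> h) w \<one>\<^bsub>G\<^esub>"

definition freely_generates :: "('g, 'b) monoid_scheme \<Rightarrow> 'g set \<Rightarrow> bool" where
  "freely_generates G S \<longleftrightarrow> S \<subseteq> carrier G \<and> generate G S = carrier G \<and>
     (\<forall>w \<in> words S. reduced w \<and> w \<noteq> [] \<longrightarrow> word_value G w \<noteq> \<one>\<^bsub>G\<^esub>)"

definition free_basis_words :: "'x set \<Rightarrow> ('x word \<times> 'x word) set \<Rightarrow> 'x word set \<Rightarrow> bool" where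
  "free_basis_words X R U \<longleftrightarrow> U \<subseteq> words X \<and> inj_on (gp_class X R) U \<and>
     freely_generates (Gp X R) (gp_class X R ` U)"

inductive_set mon_generate :: "('g, 'b) monoid_scheme \<Rightarrow> 'g set \<Rightarrow> 'g set"
  for G and S where
  one: "\<one>\<^bsub>G\<^esub> \<in> mon_generate G S"
| incl: "s \<in> S \<Longrightarrow> s \<in> mon_generate G S"
| mult: "x \<in> mon_generate G S \<Longrightarrow> y \<in> mon_generate G S \<Longrightarrow> x \<otimes>\<^bsub>G\<^esub> y \<in> mon_generate G S"


section \<open>HNN extensions\<close>

text \<open>The relations are \<open>t\<^sup>-\<^sup>1 u t = v\<close> for all words \<open>u\<close>, \<open>v\<close> representing some \<open>a \<in> A\<close>
  and its image \<open>\<phi> a\<close>, respectively; elements of \<^term>\<open>Gp X R\<close> are sets of words.\<close>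

definition hnn_relations ::
  "('x word \<times> 'x word) set \<Rightarrow> 'x \<Rightarrow> 'x word set set \<Rightarrow> ('x word set \<Rightarrow> 'x word set)
    \<Rightarrow> ('x word \<times> 'x word) set" where
  "hnn_relations R t A \<phi> =
     R \<union> {([(t, False)] @ u @ [(t, True)], v) | a u v. a \<in> A \<and> u \<in> a \<and> v \<in> \<phi> a}"

definition HNN ::
  "'x set \<Rightarrow> ('x word \<times> 'x word) set \<Rightarrow> 'x \<Rightarrow> 'x word set set \<Rightarrow> ('x word set \<Rightarrow> 'x word set)
    \<Rightarrow> 'x word set monoid" where
  "HNN X R t A \<phi> = Gp (insert t X) (hnn_relations R t A \<phi>)"

abbreviation hnn_class ::
  "'x set \<Rightarrow> ('x word \<times> 'x word) set \<Rightarrow> 'x \<Rightarrow> 'x word set set \<Rightarrow> ('x word set \<Rightarrow> 'x word set)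
    \<Rightarrow> 'x word \<Rightarrow> 'x word set" where
  "hnn_class X R t A \<phi> \<equiv> gp_class (insert t X) (hnn_relations R t A \<phi>)"

text \<open>The canonical map from the base group to the HNN extension, induced by the identity on words.\<close>

definition hnn_embed ::
  "'x set \<Rightarrow> ('x word \<times> 'x word) set \<Rightarrow> 'x \<Rightarrow> 'x word set set \<Rightarrow> ('x word set \<Rightarrow> 'x word set)
    \<Rightarrow> 'x word set \<Rightarrow> 'x word set" where
  "hnn_embed X R t A \<phi> C = (\<Union>u\<in>C. hnn_class X R t A \<phi> u)"

lemma hnn_embed_class:
  assumes "w \<in> words X"
  shows "hnn_embed X R t A \<phi> (gp_class X R w) = hnn_class X R t A \<phi> w"
proof -
  have sub: "l \<in> letters (insert t X)" if "l \<in> letters X" for l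
    using that by (auto simp: letters_def)
  have ws: "u \<in> words (insert t X)" if "u \<in> words X" for u using that sub by auto
  have mono: "gp_eq (insert t X) (hnn_relations R t A \<phi>) u v" if "gp_eq X R u v" for u v
    using that
  proof (induction rule: gp_eq.induct)
    case (rel u v)
    then show ?case by (intro gp_eq.rel ws) (auto simp: hnn_relations_def)
  next
    case (cancel l)
    then show ?case by (intro gp_eq.cancel sub)
  next
    case (refl u)
    then show ?case by (intro gp_eq.refl ws)
  next
    case (sym u v)
    show ?case by (rule gp_eq.sym[OF sym.IH])
  next
    case (trans u v w)
    show ?case by (rule gp_eq.trans[OF trans.IH])
  next
    case (append u v u' v')
    show ?case by (rule gp_eq.append[OF append.IH])
  qed
  have "hnn_class X R t A \<phi> u = hnn_class X R t A \<phi> w" if "u \<in> gp_class X R w" for u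
  proof -
    have "gp_eq X R w u" using that by (simp add: gp_class_def)
    from mono[OF this] show ?thesis using gp_class_eq_iff[OF ws[OF assms]] by metis
  qed
  moreover have "w \<in> gp_class X R w" using assms by (auto simp: gp_class_def intro: gp_eq.refl)
  ultimately show ?thesis unfolding hnn_embed_def by blast
qed


section \<open>Decidable languages\<close>

text \<open>\<open>recfn n f\<close>: the restriction of \<open>f\<close> to lists of length \<open>n\<close> is a total recursive function of
  \<open>n\<close> arguments (minimization is applied only where it yields a total function). The values of
  \<open>f\<close> on lists of any other length are irrelevant, as expressed by the rule \<open>ext\<close>.\<close>

inductive recfn :: "nat \<Rightarrow> (nat list \<Rightarrow> nat) \<Rightarrow> bool" where
  zero: "recfn n (\<lambda>_. 0)"
| succ: "recfn 1 (\<lambda>xs. Suc (xs ! 0))"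
| proj: "i < n \<Longrightarrow> recfn n (\<lambda>xs. xs ! i)"
| comp: "recfn (length gs) f \<Longrightarrow> \<forall>g\<in>set gs. recfn n g \<Longrightarrow> recfn n (\<lambda>xs. f (map (\<lambda>g. g xs) gs))"
| prim_rec: "recfn n f \<Longrightarrow> recfn (n + 2) g \<Longrightarrow>
    recfn (n + 1) (\<lambda>xs. rec_nat (f (tl xs)) (\<lambda>k r. g (k # r # tl xs)) (hd xs))"
| mu: "recfn (n + 1) f \<Longrightarrow> \<forall>xs. length xs = n \<longrightarrow> (\<exists>k. f (k # xs) = 0) \<Longrightarrow>
    recfn n (\<lambda>xs. LEAST k. f (k # xs) = 0)"
| ext: "recfn n f \<Longrightarrow> \<forall>xs. length xs = n \<longrightarrow> f xs = g xs \<Longrightarrow> recfn n g"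

text \<open>Input words over the finite alphabet \<open>\<Sigma>\<close> are coded as numbers via a numbering \<open>c\<close> of the
  letters; as \<open>\<Sigma>\<close> is finite, such numberings exist and the choice does not matter.\<close>

definition decidable_language :: "'l set \<Rightarrow> 'l list set \<Rightarrow> bool" where
  "decidable_language \<Sigma> L \<longleftrightarrow> finite \<Sigma> \<and>
     (\<forall>c :: 'l \<Rightarrow> nat. inj_on c \<Sigma> \<longrightarrow>
       (\<exists>f. recfn 1 f \<and> (\<forall>w \<in> lists \<Sigma>. f [list_encode (map c w)] = (if w \<in> L then 1 else 0))))"

definition decidable_membership ::
  "'x set \<Rightarrow> ('x word \<times> 'x word) set \<Rightarrow> 'x word set set \<Rightarrow> bool" where
  "decidable_membership X R P \<longleftrightarrow>
     decidable_language (letters X) {w \<in> words X. gp_class X R w \<in> P}"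

end

theory Submission
  imports Defs
begin

text \<open>Since \<open>\<phi>\<close> sends basis letters to basis letters, the rewriting rules
  \<open>l l\<^sup>-\<^sup>1 \<rightarrow> 1\<close>, \<open>t\<^sup>-\<^sup>1 a \<rightarrow> \<phi>(a) t\<^sup>-\<^sup>1\<close> and \<open>t b \<rightarrow> \<phi>\<^sup>-\<^sup>1(b) t\<close>, for letters \<open>a\<close> in \<open>A\<close> and
  \<open>b\<close> in \<open>B\<close> over the basis of \<open>H\<close>, do not increase length, and right multiplication acts on
  irreducible words letter by letter. This action respects the relations of the HNN extension,
  so every element has a unique normal form. As \<open>\<phi>(Q \<inter> A) = Q \<inter> B\<close>, the rules preserve the set of
  words over \<open>t\<close>, \<open>t\<^sup>-\<^sup>1\<close> and the basis letters lying in \<open>Q\<close>; hence an element belongs to \<open>P\<close> iff its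
  normal form is such a word. The basis is finite because \<open>X\<close> is, so the normal form is computed by a
  machine with finitely many transitions that keeps the normal form of the part read so far on a stack.\<close>

section \<open>Total recursive functions and two-stack machines\<close>

lemma recfn_comp1:
  assumes "recfn 1 (\<lambda>xs. F (xs ! 0))" "recfn n a"
  shows "recfn n (\<lambda>xs. F (a xs))"
  using recfn.comp[of "[a]" "\<lambda>xs. F (xs ! 0)" n] assms by simp

lemma recfn_comp2:
  assumes "recfn 2 (\<lambda>xs. F (xs ! 0) (xs ! 1))" "recfn n a" "recfn n b"
  shows "recfn n (\<lambda>xs. F (a xs) (b xs))"
  using recfn.comp[of "[a, b]" "\<lambda>xs. F (xs ! 0) (xs ! 1)" n] assms
  by (simp add: numeral_2_eq_2)

lemma recfn_comp3:
  assumes "recfn 3 (\<lambda>xs. F (xs ! 0) (xs ! 1) (xs ! 2))" "recfn n a" "recfn n b" "recfn n c"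
  shows "recfn n (\<lambda>xs. F (a xs) (b xs) (c xs))"
  using recfn.comp[of "[a, b, c]" "\<lambda>xs. F (xs ! 0) (xs ! 1) (xs ! 2)" n] assms
  by (simp add: numeral_3_eq_3 numeral_2_eq_2)

lemma recfn_Suc: "recfn n a \<Longrightarrow> recfn n (\<lambda>xs. Suc (a xs))"
  by (rule recfn_comp1[OF recfn.succ])

lemma recfn_const: "recfn n (\<lambda>_. k)"
  by (induction k) (auto intro: recfn.zero recfn_Suc)

lemma length_eq_2_iff: "length xs = 2 \<longleftrightarrow> (\<exists>a b. xs = [a, b])"
  by (auto simp: numeral_2_eq_2 length_Suc_conv)

lemma length_eq_3_iff: "length xs = 3 \<longleftrightarrow> (\<exists>a b c. xs = [a, b, c])"
  by (auto simp: numeral_3_eq_3 length_Suc_conv)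

text \<open>Primitive recursion on the condition: the base value is the branch for 0, and the step
  returns the other branch, found at index 3 behind the counter, the recursive value and the base
  branch.\<close>

lemma recfn_If:
  assumes "recfn n a" "recfn n b" "recfn n c"
  shows "recfn n (\<lambda>xs. if a xs = 0 then b xs else c xs)"
proof -
  have "recfn 2 (\<lambda>xs. xs ! 0)" "recfn (2 + 2) (\<lambda>xs. xs ! 3)"
    by (intro recfn.proj; simp)+
  then have "recfn (2 + 1) (\<lambda>xs. rec_nat (tl xs ! 0) (\<lambda>k r. (k # r # tl xs) ! 3) (hd xs))"
    by (rule recfn.prim_rec)
  then have "recfn 3 (\<lambda>xs. rec_nat (tl xs ! 0) (\<lambda>k r. (k # r # tl xs) ! 3) (hd xs))"
    by simp
  then have "recfn 3 (\<lambda>xs. if xs ! 0 = 0 then xs ! 1 else xs ! 2)"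
  proof (rule recfn.ext, intro allI impI)
    fix xs :: "nat list" assume "length xs = 3"
    then obtain a b c where "xs = [a, b, c]" by (auto simp: length_eq_3_iff)
    then show "rec_nat (tl xs ! 0) (\<lambda>k r. (k # r # tl xs) ! 3) (hd xs) = (if xs ! 0 = 0 then xs ! 1 else xs ! 2)"
      by (cases a) (auto simp: numeral_3_eq_3 numeral_2_eq_2)
  qed
  from recfn_comp3[of "\<lambda>x y z. if x = 0 then y else z", OF this assms] show ?thesis .
qed

lemma recfn_funpow:
  assumes "recfn 1 (\<lambda>xs. F (xs ! 0))" "recfn n N" "recfn n a"
  shows "recfn n (\<lambda>xs. (F ^^ N xs) (a xs))"
proof -
  have "recfn 1 (\<lambda>xs. xs ! 0)" "recfn (1 + 2) (\<lambda>xs. F (xs ! 1))"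
    by (auto intro!: recfn.proj recfn_comp1[OF assms(1)])
  then have "recfn (1 + 1) (\<lambda>xs. rec_nat (tl xs ! 0) (\<lambda>k r. F ((k # r # tl xs) ! 1)) (hd xs))"
    by (rule recfn.prim_rec)
  then have "recfn 2 (\<lambda>xs. rec_nat (tl xs ! 0) (\<lambda>k r. F ((k # r # tl xs) ! 1)) (hd xs))"
    by (simp add: numeral_2_eq_2)
  then have "recfn 2 (\<lambda>xs. (F ^^ (xs ! 0)) (xs ! 1))"
  proof (rule recfn.ext, intro allI impI)
    fix xs :: "nat list" assume "length xs = 2"
    then obtain a b where xs: "xs = [a, b]" by (auto simp: length_eq_2_iff)
    have "rec_nat b (\<lambda>k r. F r) a = (F ^^ a) b" by (induction a) auto
    then show "rec_nat (tl xs ! 0) (\<lambda>k r. F ((k # r # tl xs) ! 1)) (hd xs) = (F ^^ (xs ! 0)) (xs ! 1)"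
      by (simp add: xs)
  qed
  from recfn_comp2[of "\<lambda>k x. (F ^^ k) x", OF this assms(2,3)] show ?thesis .
qed

lemma recfn_rec1:
  assumes "recfn 2 (\<lambda>xs. G (xs ! 0) (xs ! 1))" "recfn n a"
  shows "recfn n (\<lambda>xs. rec_nat k G (a xs))"
proof -
  have "recfn (0 + 1) (\<lambda>xs. rec_nat ((\<lambda>_. k) (tl xs)) (\<lambda>k r. G ((k # r # tl xs) ! 0) ((k # r # tl xs) ! 1)) (hd xs))"
    by (rule recfn.prim_rec) (use assms(1) in \<open>simp_all add: recfn_const numeral_2_eq_2\<close>)
  then have "recfn 1 (\<lambda>xs. rec_nat k G (hd xs))" by simp
  then have "recfn 1 (\<lambda>xs. rec_nat k G (xs ! 0))"
    by (rule recfn.ext) (auto simp: length_Suc_conv)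
  from recfn_comp1[of "rec_nat k G", OF this assms(2)] show ?thesis .
qed

lemma recfn_pred:
  assumes "recfn n a"
  shows "recfn n (\<lambda>xs. a xs - 1)"
proof -
  have "rec_nat 0 (\<lambda>k r. k) m = m - 1" for m :: nat by (cases m) auto
  then show ?thesis using recfn_rec1[of "\<lambda>k r. k" n a 0, OF recfn.proj assms] by simp
qed

lemma recfn_diff:
  assumes "recfn n a" "recfn n b"
  shows "recfn n (\<lambda>xs. a xs - b xs)"
proof -
  have "((\<lambda>x. x - 1) ^^ k) m = m - k" for k m :: nat by (induction k) auto
  then show ?thesis
    using recfn_funpow[of "\<lambda>x. x - 1" n b a, OF recfn_pred[OF recfn.proj] assms(2,1)] by simp
qed

lemma recfn_add:
  assumes "recfn n a" "recfn n b"
  shows "recfn n (\<lambda>xs. a xs + b xs)"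
proof -
  have "(Suc ^^ k) m = m + k" for k m :: nat by (induction k) auto
  then show ?thesis
    using recfn_funpow[of Suc n b a, OF recfn_Suc[OF recfn.proj] assms(2,1)] by (simp add: add.commute)
qed

lemma recfn_triangle:
  assumes "recfn n a"
  shows "recfn n (\<lambda>xs. triangle (a xs))"
proof -
  have "rec_nat 0 (\<lambda>k r. r + Suc k) m = triangle m" for m by (induction m) auto
  then show ?thesis
    using recfn_rec1[of "\<lambda>k r. r + Suc k" n a 0, OF recfn_add[OF recfn.proj recfn_Suc[OF recfn.proj]] assms]
    by simp
qed

lemma recfn_prod_encode:
  assumes "recfn n a" "recfn n b"
  shows "recfn n (\<lambda>xs. prod_encode (a xs, b xs))"
  unfolding prod_encode_def using assms by (auto intro!: recfn_add recfn_triangle)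

lemma triangle_mono: "m \<le> n \<Longrightarrow> triangle m \<le> triangle n"
  by (rule lift_Suc_mono_le[of triangle]) auto

text \<open>\<open>prod_encode (x, y)\<close> is \<open>triangle (x + y) + x\<close>, so it first
  lies below \<open>triangle (Suc k)\<close> for \<open>k = x + y\<close>; the outer
  \<open>Suc\<close> lets truncated subtraction express strict inequality. Minimization thus
  recovers \<open>x + y\<close>, and with it both components.\<close>

lemma Least_triangle:
  "(LEAST k. Suc (prod_encode (x, y)) - triangle (Suc k) = 0) = x + y"
proof (rule Least_equality)
  show "Suc (prod_encode (x, y)) - triangle (Suc (x + y)) = 0"
    by (simp add: prod_encode_def)
  fix k assume "Suc (prod_encode (x, y)) - triangle (Suc k) = 0"
  then have "triangle (x + y) < triangle (Suc k)" by (simp add: prod_encode_def)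
  then have "\<not> Suc k \<le> x + y" using triangle_mono[of "Suc k" "x + y"] by linarith
  then show "x + y \<le> k" by simp
qed

lemma recfn_prod_decode:
  assumes "recfn n a"
  shows "recfn n (\<lambda>xs. fst (prod_decode (a xs)))" "recfn n (\<lambda>xs. snd (prod_decode (a xs)))"
proof -
  define s where "s m = (LEAST k. Suc m - triangle (Suc k) = 0)" for m
  have ex: "\<exists>k. Suc m - triangle (Suc k) = 0" for m
    by (rule exI[of _ m], induction m) auto
  have "recfn 1 (\<lambda>xs. LEAST k. (\<lambda>ys. Suc (ys ! 1) - triangle (Suc (ys ! 0))) (k # xs) = 0)"
    by (rule recfn.mu)
      (auto intro!: recfn_diff recfn_Suc recfn_triangle recfn.proj ex simp del: triangle_Suc diff_is_0_eq diff_is_0_eq')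
  then have "recfn 1 (\<lambda>xs. s (xs ! 0))" by (simp add: s_def)
  then have s: "recfn n (\<lambda>xs. s (a xs))" by (rule recfn_comp1[OF _ assms])
  have eq: "fst (prod_decode m) = m - triangle (s m)" "snd (prod_decode m) = s m - (m - triangle (s m))" for m
  proof -
    obtain x y where m: "m = prod_encode (x, y)" by (metis prod_decode_inverse surj_pair)
    show "fst (prod_decode m) = m - triangle (s m)" "snd (prod_decode m) = s m - (m - triangle (s m))"
      unfolding s_def m Least_triangle by (simp_all add: prod_encode_inverse) (simp_all add: prod_encode_def)
  qed
  show "recfn n (\<lambda>xs. fst (prod_decode (a xs)))" "recfn n (\<lambda>xs. snd (prod_decode (a xs)))"
    unfolding eq by (intro recfn_diff recfn_triangle s assms)+
qed

section \<open>Lists coded as numbers\<close>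

definition hd_code :: "nat \<Rightarrow> nat" where "hd_code x = fst (prod_decode (x - 1))"
definition tl_code :: "nat \<Rightarrow> nat" where "tl_code x = snd (prod_decode (x - 1))"

lemma hd_code_Cons [simp]: "hd_code (list_encode (x # xs)) = x"
  by (simp add: hd_code_def prod_encode_inverse)

lemma tl_code [simp]: "tl_code (list_encode xs) = list_encode (tl xs)"
proof -
  \<comment> \<open>The predecessor of the code 0 is again 0, so the empty list depends on
    \<open>prod_decode 0\<close>, which makes its tail empty.\<close>
  have "prod_encode (0, 0) = 0" by (simp add: prod_encode_def)
  then have "prod_decode 0 = (0, 0)" by (metis prod_encode_inverse)
  then show ?thesis by (cases xs) (simp_all add: tl_code_def)
qed

lemma recfn_hd_code: "recfn n a \<Longrightarrow> recfn n (\<lambda>xs. hd_code (a xs))"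
  and recfn_tl_code: "recfn n a \<Longrightarrow> recfn n (\<lambda>xs. tl_code (a xs))"
  unfolding hd_code_def tl_code_def by (intro recfn_prod_decode recfn_pred; assumption)+

lemma list_encode_eq_0_iff [simp]: "list_encode xs = 0 \<longleftrightarrow> xs = []"
  by (cases xs) auto

text \<open>The code itself thus bounds the number of rounds of a loop that consumes the
  list.\<close>

lemma length_le_list_encode: "length xs \<le> list_encode xs"
proof (induction xs)
  case (Cons x xs)
  then show ?case using le_prod_encode_2[of "list_encode xs" x] by simp
qed simp

lemma recfn_append_const:
  assumes "recfn n (\<lambda>xs. list_encode (f xs))"
  shows "recfn n (\<lambda>xs. list_encode (zs @ f xs))"
  by (induction zs) (auto intro!: recfn_Suc recfn_prod_encode recfn_const assms)

text \<open>Induction over \<open>K\<close> adds one equality test per key, equality meaning that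
  both truncated differences vanish. As \<open>h k\<close> must be recursive only for each fixed
  \<open>k\<close>, any finite table can be hardwired, however it was obtained.\<close>

lemma recfn_table:
  assumes "finite K" "recfn n p" "\<And>k. k \<in> K \<Longrightarrow> recfn n (h k)" "recfn n g"
  shows "recfn n (\<lambda>xs. if p xs \<in> K then h (p xs) xs else g xs)"
  using assms(1,3)
proof (induction K rule: finite_induct)
  case empty
  then show ?case using assms(4) by simp
next
  case (insert k K)
  have "recfn n (\<lambda>xs. if (p xs - k) + (k - p xs) = 0 then h k xs
      else if p xs \<in> K then h (p xs) xs else g xs)"
    by (intro recfn_If recfn_add recfn_diff recfn_const assms insert.IH insert.prems) auto
  moreover have "(if (p xs - k) + (k - p xs) = 0 then h k xs
      else if p xs \<in> K then h (p xs) xs else g xs)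
    = (if p xs \<in> insert k K then h (p xs) xs else g xs)" for xs
    by auto
  ultimately show ?case by simp
qed

lemma recfn_lists_subset:
  assumes "finite S" "recfn n a"
  shows "recfn n (\<lambda>xs. if list_decode (a xs) \<in> lists S then 1 else 0)"
proof -
  \<comment> \<open>\<open>g\<close> removes the head while it lies in \<open>S\<close> and is stuck
    otherwise, with the empty list as a fixed point; enough iterations reach 0 exactly for lists
    over \<open>S\<close>.\<close>
  define g where "g u = (if hd_code u \<in> S then if u = 0 then u else tl_code u else u)" for u
  have "recfn 1 (\<lambda>xs. if hd_code (xs ! 0) \<in> S then (if xs ! 0 = 0 then xs ! 0 else tl_code (xs ! 0)) else xs ! 0)"
    by (rule recfn_table) (auto intro!: assms recfn_If recfn_hd_code recfn_tl_code recfn.proj)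
  then have "recfn 1 (\<lambda>xs. g (xs ! 0))" by (simp add: g_def)
  then have "recfn n (\<lambda>xs. if (g ^^ a xs) (a xs) = 0 then 1 else 0)"
    by (intro recfn_If recfn_funpow recfn_const assms)
  moreover have "(g ^^ k) (list_encode us) = 0 \<longleftrightarrow> us \<in> lists S" if "length us \<le> k" for k us
    using that
  proof (induction us arbitrary: k)
    case Nil
    have "(g ^^ k) 0 = 0" by (induction k) (auto simp: g_def)
    then show ?case by simp
  next
    case (Cons u us)
    then obtain k' where k: "k = Suc k'" by (cases k) auto
    show ?case
    proof (cases "u \<in> S")
      case True
      then have "g (list_encode (u # us)) = list_encode us"
        unfolding g_def hd_code_Cons tl_code by simp
      then show ?thesis using Cons True by (simp add: k funpow_swap1[symmetric] del: list_encode.simps funpow.simps)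
          (simp add: funpow_swap1)
    next
      case False
      then have "g (list_encode (u # us)) = list_encode (u # us)"
        unfolding g_def hd_code_Cons by simp
      then have "(g ^^ k) (list_encode (u # us)) = list_encode (u # us)" by (induction k) auto
      then show ?thesis using False by simp
    qed
  qed
  from this[OF length_le_list_encode]
  have "(g ^^ m) m = 0 \<longleftrightarrow> list_decode m \<in> lists S" for m
    by (metis list_decode_inverse)
  ultimately show ?thesis by simp
qed

section \<open>Machines with a stack and an input list\<close>

definition hd_opt :: "'a list \<Rightarrow> 'a option" where
  "hd_opt u = (case u of [] \<Rightarrow> None | d # _ \<Rightarrow> Some d)"

text \<open>A state consists of a stack and the remaining input; the transition \<open>\<delta>\<close> sees the next input letter
  and the top of the stack and says what replaces the top and what is put back in front of the input.\<close>

fun machine_step :: "('a \<Rightarrow> 'a option \<Rightarrow> 'a list \<times> 'a list) \<Rightarrow> 'a list \<times> 'a list \<Rightarrow> 'a list \<times> 'a list" where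
  "machine_step \<delta> (u, []) = (u, [])"
| "machine_step \<delta> (u, c # v) = (fst (\<delta> c (hd_opt u)) @ tl u, snd (\<delta> c (hd_opt u)) @ v)"

definition reaches :: "('s \<Rightarrow> 's) \<Rightarrow> 's \<Rightarrow> 's \<Rightarrow> bool" where
  "reaches f a b \<longleftrightarrow> (\<exists>k. (f ^^ k) a = b)"

lemma reaches_refl: "reaches f a a"
  unfolding reaches_def by (rule exI[of _ 0]) simp

lemma reaches_step: "f a = b \<Longrightarrow> reaches f b c \<Longrightarrow> reaches f a c"
  unfolding reaches_def by (metis funpow_simps_right(2) comp_apply)

lemma reaches_trans: "reaches f a b \<Longrightarrow> reaches f b c \<Longrightarrow> reaches f a c"
  unfolding reaches_def by (metis funpow_add comp_apply)

definition state_code :: "('a \<Rightarrow> nat) \<Rightarrow> 'a list \<times> 'a list \<Rightarrow> nat" where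
  "state_code e s = prod_encode (list_encode (map e (fst s)), list_encode (map e (snd s)))"

text \<open>Over the finite alphabet \<open>S\<close> only finitely many pairs of input letter and
  stack top occur, so an arbitrary \<open>\<delta>\<close> becomes a finite table. Nothing is
  claimed about other states.\<close>

lemma recfn_machine_step:
  fixes e :: "'a \<Rightarrow> nat"
  assumes "finite S" "inj_on e S"
  shows "\<exists>F. recfn 1 (\<lambda>xs. F (xs ! 0)) \<and>
    (\<forall>u\<in>lists S. \<forall>v\<in>lists S. F (state_code e (u, v)) = state_code e (machine_step \<delta> (u, v)))"
proof -
  \<comment> \<open>0 stands for the empty stack, so codes of letters are shifted by one;
    \<open>eo\<close> makes the same shift for \<open>hd_opt\<close>.\<close>
  define top where "top u = (if u = 0 then 0 else Suc (hd_code u))" for u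
  define st where "st x = fst (prod_decode x)" for x
  define inp where "inp x = snd (prod_decode x)" for x
  define eo where "eo d = (case d of None \<Rightarrow> 0 | Some d \<Rightarrow> Suc (e d))" for d
  define E where "E = (\<lambda>(c, d). prod_encode (e c, eo d))"
  define D where "D = S \<times> insert None (Some ` S)"
  define key where "key x = prod_encode (hd_code (inp x), top (st x))" for x
  \<comment> \<open>Row \<open>k\<close> of the table: the key is decoded by inverting
    \<open>E\<close> on \<open>D\<close>, and the lists found there are put in front of the rest of
    stack and input.\<close>
  define h where "h k x = (let y = \<delta> (fst (inv_into D E k)) (snd (inv_into D E k))
     in prod_encode (list_encode (map e (fst y) @ list_decode (tl_code (st x))),
       list_encode (map e (snd y) @ list_decode (tl_code (inp x)))))" for k x
  define F where "F x = (if inp x = 0 then x else if key x \<in> E ` D then h (key x) x else 0)" for x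
  have D: "finite D" using assms by (simp add: D_def)
  have "inj_on E D"
    using assms(2) by (auto simp: inj_on_def D_def E_def eo_def split: option.splits)
  have st: "recfn 1 (\<lambda>xs. st (xs ! 0))" and inp: "recfn 1 (\<lambda>xs. inp (xs ! 0))"
    unfolding st_def inp_def by (auto intro!: recfn_prod_decode recfn.proj)
  have key: "recfn 1 (\<lambda>xs. key (xs ! 0))"
    unfolding key_def top_def
    by (intro recfn_prod_encode recfn_hd_code recfn_If recfn_Suc recfn_const st inp)
  have h: "recfn 1 (\<lambda>xs. h k (xs ! 0))" for k
    unfolding h_def Let_def
    by (intro recfn_prod_encode recfn_append_const) (simp_all only: list_decode_inverse recfn_tl_code st inp)
  have "recfn 1 (\<lambda>xs. if key (xs ! 0) \<in> E ` D then (\<lambda>k xs. h k (xs ! 0)) (key (xs ! 0)) xs else 0)"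
    by (rule recfn_table) (use D key h recfn_const in auto)
  then have "recfn 1 (\<lambda>xs. F (xs ! 0))"
    unfolding F_def by (intro recfn_If inp) (auto intro: recfn.proj)
  moreover have "F (state_code e (u, v)) = state_code e (machine_step \<delta> (u, v))"
    if u: "u \<in> lists S" and v: "v \<in> lists S" for u v
  proof (cases v)
    case Nil
    then show ?thesis by (simp add: F_def inp_def state_code_def)
  next
    case (Cons c v')
    let ?x = "state_code e (u, v)"
    have inp: "inp ?x = list_encode (map e v)" and st: "st ?x = list_encode (map e u)"
      by (simp_all add: state_code_def inp_def st_def)
    have "top (st ?x) = eo (hd_opt u)"
      unfolding st by (cases u) (simp_all add: top_def eo_def hd_opt_def del: list_encode.simps)
    then have key: "key ?x = E (c, hd_opt u)"
      unfolding key_def inp by (simp add: E_def Cons del: list_encode.simps)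
    have inD: "(c, hd_opt u) \<in> D"
      using u v Cons by (cases u) (auto simp: D_def hd_opt_def)
    then have inv: "inv_into D E (key ?x) = (c, hd_opt u)"
      unfolding key using \<open>inj_on E D\<close> by (rule inv_into_f_f[rotated])
    have "inp ?x \<noteq> 0" unfolding inp by (simp add: Cons)
    moreover have "key ?x \<in> E ` D" using key inD by simp
    ultimately have "F ?x = h (key ?x) ?x" by (simp add: F_def)
    also have "\<dots> = state_code e (machine_step \<delta> (u, v))"
      unfolding h_def Let_def inv st inp
      by (simp add: state_code_def Cons map_tl del: list_encode.simps)
    finally show ?thesis .
  qed
  ultimately show ?thesis by blast
qed

text \<open>The running time is found by minimization: the machine has halted once the code of the
  input list is 0. The stack reached at that time is then tested against \<open>L\<close>.\<close>

lemma machine_decides: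
  fixes e :: "'a \<Rightarrow> nat"
  assumes "finite S" "inj_on e S" "L \<subseteq> S"
    and closed: "\<And>c d. c \<in> S \<Longrightarrow> d \<in> insert None (Some ` S) \<Longrightarrow> fst (\<delta> c d) \<in> lists S \<and> snd (\<delta> c d) \<in> lists S"
    and result: "\<And>v. v \<in> lists S \<Longrightarrow> reaches (machine_step \<delta>) ([], v) (r v, [])"
  shows "\<exists>f. recfn 1 f \<and> (\<forall>v\<in>lists S. f [list_encode (map e v)] = (if r v \<in> lists L then 1 else 0))"
proof -
  obtain F where F: "recfn 1 (\<lambda>xs. F (xs ! 0))"
    and step: "\<And>u v. u \<in> lists S \<Longrightarrow> v \<in> lists S \<Longrightarrow> F (state_code e (u, v)) = state_code e (machine_step \<delta> (u, v))"
    using recfn_machine_step[OF assms(1,2), of \<delta>] by blast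
  define st where "st k v = (machine_step \<delta> ^^ k) ([], v)" for k v
  have lists: "fst (machine_step \<delta> s) \<in> lists S \<and> snd (machine_step \<delta> s) \<in> lists S"
    if "fst s \<in> lists S" "snd s \<in> lists S" for s
  proof (cases s)
    case (Pair u v)
    show ?thesis
    proof (cases v)
      case (Cons c v')
      have "hd_opt u \<in> insert None (Some ` S)" "c \<in> S"
        using that Pair Cons by (auto simp: hd_opt_def split: list.splits)
      from closed[OF this(2,1)] show ?thesis
        using that Pair Cons by (cases u) auto
    qed (use that Pair in auto)
  qed
  have st_lists: "fst (st k v) \<in> lists S \<and> snd (st k v) \<in> lists S" if "v \<in> lists S" for k v
  proof (induction k)
    case (Suc k)
    then show ?case using lists[of "st k v"] by (simp add: st_def)
  qed (use that in \<open>simp add: st_def\<close>)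
  have Fk: "(F ^^ k) (state_code e ([], v)) = state_code e (st k v)" if "v \<in> lists S" for k v
  proof (induction k)
    case (Suc k)
    then show ?case using step[of "fst (st k v)" "snd (st k v)"] st_lists[OF that, of k]
      by (simp add: st_def)
  qed (simp add: st_def)
  \<comment> \<open>Minimization needs the machine to halt on every number, so inputs with letters outside \<open>S\<close> are erased.\<close>
  define sane where "sane x = (if (if list_decode x \<in> lists (e ` S) then 1 else 0 :: nat) = 0 then 0 else x)" for x
  have sane: "recfn n (\<lambda>xs. sane (a xs))" if "recfn n a" for n a
    unfolding sane_def using assms(1) that by (intro recfn_If recfn_lists_subset recfn_const) auto
  have sane_code: "\<exists>v\<in>lists S. sane x = list_encode (map e v)" for x
  proof (cases "list_decode x \<in> lists (e ` S)")
    case True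
    then have "list_decode x \<in> map e ` lists S" by (simp add: lists_image)
    then obtain v where "v \<in> lists S" "list_decode x = map e v" by blast
    then show ?thesis using True by (metis list_decode_inverse sane_def zero_neq_one)
  next
    case False
    then show ?thesis by (intro bexI[of _ "[]"]) (auto simp: sane_def)
  qed
  have sane_id: "sane (list_encode (map e v)) = list_encode (map e v)" if "v \<in> lists S" for v
    using that by (auto simp: sane_def)
  \<comment> \<open>The first component 0 is the code of the empty stack.\<close>
  define run where "run k x = (F ^^ k) (prod_encode (0, sane x))" for k x
  have run: "recfn n (\<lambda>xs. run (a xs) (b xs))" if "recfn n a" "recfn n b" for n a b
    unfolding run_def using that by (intro recfn_funpow F recfn_prod_encode recfn_const sane)
  have run_eq: "run k x = state_code e (st k v)" if "v \<in> lists S" "sane x = list_encode (map e v)" for k x v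
    using Fk[OF that(1), of k] that(2) by (simp add: run_def state_code_def)
  define halt where "halt x = (LEAST k. snd (prod_decode (run k x)) = 0)" for x
  have ex: "\<exists>k. snd (prod_decode (run k x)) = 0" for x
  proof -
    obtain v where v: "v \<in> lists S" "sane x = list_encode (map e v)" using sane_code by blast
    obtain k where "st k v = (r v, [])" using result[OF v(1)] by (auto simp: reaches_def st_def)
    then show ?thesis by (intro exI[of _ k]) (simp add: run_eq[OF v] state_code_def)
  qed
  have "recfn 1 (\<lambda>xs. LEAST k. (\<lambda>ys. snd (prod_decode (run (ys ! 0) (ys ! 1)))) (k # xs) = 0)"
    by (rule recfn.mu) (auto intro!: recfn_prod_decode run recfn.proj ex)
  then have "recfn 1 (\<lambda>xs. halt (xs ! 0))" by (simp add: halt_def)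
  then have "recfn 1 (\<lambda>xs. if list_decode (fst (prod_decode (run (halt (xs ! 0)) (xs ! 0)))) \<in> lists (e ` L) then 1 else 0)"
    using assms(1,3) by (intro recfn_lists_subset recfn_prod_decode run) (auto intro: finite_subset recfn.proj)
  moreover have "(list_decode (fst (prod_decode (run (halt x) x))) \<in> lists (e ` L)) = (r v \<in> lists L)"
    if v: "v \<in> lists S" and x: "x = list_encode (map e v)" for v x
  proof -
    have sx: "sane x = list_encode (map e v)" using sane_id v x by simp
    obtain k where k: "st k v = (r v, [])" using result[OF v] by (auto simp: reaches_def st_def)
    have "snd (prod_decode (run (halt x) x)) = 0"
      unfolding halt_def by (rule LeastI_ex[OF ex])
    then have nil: "snd (st (halt x) v) = []" by (simp add: run_eq[OF v sx] state_code_def)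
    have "halt x \<le> k" unfolding halt_def by (rule Least_le) (simp add: run_eq[OF v sx] state_code_def k)
    \<comment> \<open>A state with empty input is fixed, so the first halting state agrees with the
      one at the time \<open>k\<close> supplied by \<open>result\<close>.\<close>
    have stay: "st (m + halt x) v = st (halt x) v" for m
    proof (induction m)
      case (Suc m)
      then show ?case using nil by (cases "st (halt x) v") (simp add: st_def)
    qed simp
    from this[of "k - halt x"] \<open>halt x \<le> k\<close> have "st (halt x) v = (r v, [])" by (simp add: k)
    then have run: "list_decode (fst (prod_decode (run (halt x) x))) = map e (r v)"
      by (simp add: run_eq[OF v sx] state_code_def)
    have "set (r v) \<subseteq> S" using st_lists[OF v, of k] k by auto
    then have "x \<in> L \<longleftrightarrow> e x \<in> e ` L" if "x \<in> set (r v)" for x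
      using inj_on_image_mem_iff[OF assms(2) _ assms(3)] that by blast
    then show ?thesis by (simp add: run in_lists_conv_set)
  qed
  ultimately show ?thesis by (intro exI[of _ "\<lambda>xs. if list_decode (fst (prod_decode (run (halt (xs ! 0)) (xs ! 0)))) \<in> lists (e ` L) then 1 else 0"]) simp
qed

section \<open>Normal forms kept on a stack\<close>

lemma inv_letter_inv_letter [simp]: "inv_letter (inv_letter l) = l"
  by (simp add: inv_letter_def)

lemma inv_letter_eq_iff [simp]: "inv_letter k = inv_letter l \<longleftrightarrow> k = l"
  by (metis inv_letter_inv_letter)

lemma inv_letter_in_letters [simp]: "inv_letter l \<in> letters X \<longleftrightarrow> l \<in> letters X"
  by (simp add: letters_def inv_letter_def mem_Times_iff)

lemma inv_word_Nil [simp]: "inv_word [] = []"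
  by (simp add: inv_word_def)

lemma inv_word_Cons: "inv_word (l # w) = inv_word w @ [inv_letter l]"
  by (simp add: inv_word_def)

lemma inv_word_append: "inv_word (u @ v) = inv_word v @ inv_word u"
  by (simp add: inv_word_def)

lemma inv_word_inv_word [simp]: "inv_word (inv_word w) = w"
  by (simp add: inv_word_def rev_map o_def)

text \<open>The head of a stack is the last letter of the word it stores. \<open>p e c = Some c'\<close> stands for the
  rewriting rule \<open>e c \<rightarrow> c' e\<close>, and \<^term>\<open>push p c s\<close> multiplies the stored word by \<open>c\<close> on the right.\<close>

fun push :: "('a letter \<Rightarrow> 'a letter \<Rightarrow> 'a letter option) \<Rightarrow> 'a letter \<Rightarrow> 'a word \<Rightarrow> 'a word" where
  "push p c [] = [c]"
| "push p c (d # s) = (if d = inv_letter c then s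
     else case p d c of None \<Rightarrow> c # d # s | Some c' \<Rightarrow> d # push p c' s)"

text \<open>Since the head is the last letter, \<open>e\<close> stands to the left of
  \<open>d\<close> in the stored word; hence the order of arguments in \<open>p e d\<close>.\<close>

definition irreducible :: "('a letter \<Rightarrow> 'a letter \<Rightarrow> 'a letter option) \<Rightarrow> 'a word \<Rightarrow> bool" where
  "irreducible p = successively (\<lambda>d e. e \<noteq> inv_letter d \<and> p e d = None)"

lemma irreducible_simps [simp]:
  "irreducible p []" "irreducible p [d]"
  "irreducible p (d # e # s) \<longleftrightarrow> e \<noteq> inv_letter d \<and> p e d = None \<and> irreducible p (e # s)"
  by (auto simp: irreducible_def)

lemma irreducible_ConsD: "irreducible p (d # s) \<Longrightarrow> irreducible p s"
  by (cases s) auto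

lemma push_irreducible: "irreducible p (c # s) \<Longrightarrow> push p c s = c # s"
  by (cases s) auto

text \<open>A commutation step pops \<open>e\<close> and puts \<open>c' e\<close> back in front of the input, so that the machine need
  not remember how deep it is in the stack. Input letters are tagged \<^const>\<open>Inl\<close> until they are
  expanded by \<open>f\<close>.\<close>

fun stack_rule :: "('a letter \<Rightarrow> 'a letter \<Rightarrow> 'a letter option) \<Rightarrow> ('b \<Rightarrow> 'a word) \<Rightarrow>
    'b + 'a letter \<Rightarrow> ('b + 'a letter) option \<Rightarrow> ('b + 'a letter) list \<times> ('b + 'a letter) list" where
  "stack_rule p f (Inl x) d = ((case d of None \<Rightarrow> [] | Some d \<Rightarrow> [d]), map Inr (f x))"
| "stack_rule p f (Inr c) (Some (Inr d)) = (if d = inv_letter c then ([], [])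
     else case p d c of None \<Rightarrow> ([Inr c, Inr d], []) | Some c' \<Rightarrow> ([], [Inr c', Inr d]))"
| "stack_rule p f (Inr c) (Some (Inl y)) = ([Inr c, Inl y], [])"
| "stack_rule p f (Inr c) None = ([Inr c], [])"

text \<open>Abstracts conjugation by a stable letter: the inverse stable letter undoes an exchange,
  exchanges respect inverses, and only letters outside \<open>T\<close> pass letters of
  \<open>T\<close>, so no letter plays both roles.\<close>

locale passing =
  fixes p :: "'a letter \<Rightarrow> 'a letter \<Rightarrow> 'a letter option" and T :: "'a letter set"
  assumes pass_back: "p e c = Some c' \<Longrightarrow> p (inv_letter e) c' = Some c"
    and pass_inv: "p e c = Some c' \<Longrightarrow> p e (inv_letter c) = Some (inv_letter c')"
    and pass_stable: "p e c = Some c' \<Longrightarrow> e \<in> T \<and> c \<notin> T \<and> c' \<notin> T"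
    and stable_inv: "e \<in> T \<Longrightarrow> inv_letter e \<in> T"
begin

lemma pass_None: "d \<notin> T \<Longrightarrow> p d c = None" "c \<in> T \<Longrightarrow> p d c = None"
  using pass_stable by (cases "p d c"; blast)+

lemma pass_not_inv: "p e c = Some c' \<Longrightarrow> e \<noteq> inv_letter c \<and> e \<noteq> inv_letter c' \<and> c' \<noteq> inv_letter e \<and> e \<noteq> c \<and> e \<noteq> c'"
  using pass_stable[of e c c'] stable_inv[of "inv_letter c"] stable_inv[of "inv_letter c'"]
  by (metis inv_letter_inv_letter stable_inv)

text \<open>The critical case is \<open>c'\<close> cancelling the top of \<open>s\<close> and
  exposing the inverse of \<open>d\<close>. Then \<open>pass_back\<close> and
  \<open>pass_inv\<close> would give a rule for the two topmost letters of \<open>s\<close>, against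
  irreducibility.\<close>

lemma irreducible_Cons_push:
  assumes "irreducible p (d # s)" "p d c = Some c'" "irreducible p (push p c' s)"
  shows "irreducible p (d # push p c' s)"
proof -
  note d = pass_stable[OF assms(2)] pass_not_inv[OF assms(2)]
  show ?thesis
  proof (cases s)
    case Nil
    then show ?thesis using d pass_None by auto
  next
    case (Cons e s')
    show ?thesis
    proof (cases "e = inv_letter c'")
      case True
      show ?thesis
      proof (cases s')
        case (Cons e' s'')
        have "e' \<noteq> inv_letter d"
        proof
          assume "e' = inv_letter d"
          then have "p e' e = Some (inv_letter c)" using True pass_back pass_inv assms(2) by blast
          then show False using assms(1) \<open>s = e # s'\<close> Cons by simp
        qed
        then show ?thesis
          using assms \<open>s = e # s'\<close> Cons True d pass_None(2)[of d] by simp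
      qed (use True Cons in simp)
    next
      case False
      then show ?thesis using assms Cons d pass_None
        by (auto split: option.splits)
    qed
  qed
qed

lemma irreducible_push: "irreducible p s \<Longrightarrow> irreducible p (push p c s)"
proof (induction s arbitrary: c)
  case (Cons d s)
  then show ?case
    using irreducible_Cons_push[of d s c] irreducible_ConsD[of p d s]
    by (auto split: option.splits)
qed simp

lemma push_inv_push: "irreducible p s \<Longrightarrow> push p (inv_letter c) (push p c s) = s"
proof (induction s arbitrary: c)
  case (Cons d s)
  show ?case
  proof (cases "d = inv_letter c")
    case True
    then show ?thesis using Cons.prems push_irreducible[of p d s] by simp
  next
    case False
    show ?thesis
    proof (cases "p d c")
      case (Some c')
      then show ?thesis
        using False Cons.IH[of c'] irreducible_ConsD[OF Cons.prems] pass_inv[OF Some] pass_not_inv[OF Some]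
        by simp
    qed (use False in simp)
  qed
qed simp

text \<open>If \<open>e\<close> cancels the top of the stack, then on the other side
  \<open>c'\<close> passes that top by \<open>pass_back\<close> and comes out as \<open>c\<close>;
  otherwise \<open>e\<close> lands on top and the rule itself applies.\<close>

lemma push_pass:
  assumes "p e c = Some c'" "irreducible p s"
  shows "push p c (push p e s) = push p e (push p c' s)"
proof -
  note e = pass_stable[OF assms(1)] pass_not_inv[OF assms(1)]
  show ?thesis
  proof (cases "\<exists>s'. s = inv_letter e # s'")
    case True
    then obtain s' where s: "s = inv_letter e # s'" by blast
    have "inv_letter e \<noteq> inv_letter c'" using e by simp
    then show ?thesis using s pass_back[OF assms(1)] by simp
  next
    case False
    then have irr: "irreducible p (e # s)"
      using assms(2) e pass_None(2)[of e] by (cases s) auto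
    have "push p c (push p e s) = e # push p c' s"
      using push_irreducible[OF irr] assms(1) e by simp
    also have "\<dots> = push p e (push p c' s)"
      by (intro push_irreducible[symmetric] irreducible_Cons_push[OF irr assms(1)] irreducible_push assms(2))
    finally show ?thesis .
  qed
qed

lemma irreducible_fold_push: "irreducible p s \<Longrightarrow> irreducible p (fold (push p) z s)"
  by (induction z arbitrary: s) (auto intro: irreducible_push)

lemma fold_push_inv_word: "irreducible p s \<Longrightarrow> fold (push p) (inv_word z) (fold (push p) z s) = s"
  by (induction z arbitrary: s) (auto simp: inv_word_Cons push_inv_push irreducible_push)

lemma fold_push_pass:
  assumes "list_all2 (\<lambda>c c'. p e c = Some c') z z'" "irreducible p s"
  shows "fold (push p) z (push p e s) = push p e (fold (push p) z' s)"
  using assms by (induction arbitrary: s rule: list_all2_induct) (auto simp: push_pass irreducible_push)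

text \<open>Without letters of \<open>T\<close> on the stack a letter is only stacked or cancelled,
  never rewritten. This serves the finiteness of the basis.\<close>

lemma set_push_stable_free: "set s \<inter> T = {} \<Longrightarrow> set (push p c s) \<subseteq> insert c (set s)"
  using pass_None(1) by (cases s) auto

lemma set_fold_push_stable_free:
  "set s \<inter> T = {} \<Longrightarrow> set z \<inter> T = {} \<Longrightarrow> set (fold (push p) z s) \<subseteq> set z \<union> set s"
proof (induction z arbitrary: s)
  case (Cons c z)
  have "set (push p c s) \<inter> T = {}" using Cons.prems set_push_stable_free[of s c] by auto
  from Cons.IH[OF this] show ?case using Cons.prems set_push_stable_free[of s c] by auto
qed simp

text \<open>Only the rules need to preserve \<open>L\<close>; for the letters of \<open>P\<close>
  this is where the compatibility of \<open>\<phi>\<close> with \<open>Q\<close> will enter.\<close>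

lemma push_lists:
  assumes "\<And>e c c'. p e c = Some c' \<Longrightarrow> c \<in> L \<Longrightarrow> c' \<in> L"
  shows "c \<in> L \<Longrightarrow> s \<in> lists L \<Longrightarrow> push p c s \<in> lists L"
  by (induction s arbitrary: c) (auto split: option.splits dest: assms)

lemma fold_push_lists:
  assumes "\<And>e c c'. p e c = Some c' \<Longrightarrow> c \<in> L \<Longrightarrow> c' \<in> L"
  shows "z \<in> lists L \<Longrightarrow> s \<in> lists L \<Longrightarrow> fold (push p) z s \<in> lists L"
proof (induction z arbitrary: s)
  case (Cons c z)
  then show ?case using push_lists[of L c s] assms by auto
qed simp

text \<open>In the commuting case the machine pops \<open>d\<close>, treats \<open>c'\<close> on the
  shorter stack by induction, and meets \<open>d\<close> again in the input. By
  \<open>irreducible_Cons_push\<close> this \<open>d\<close> simply lands on top.\<close>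

lemma reaches_push:
  assumes "irreducible p s"
  shows "reaches (machine_step (stack_rule p f)) (map Inr s, Inr c # v) (map Inr (push p c s), v)"
  using assms
proof (induction s arbitrary: c v)
  case Nil
  have "machine_step (stack_rule p f) (map Inr [], Inr c # v) = (map Inr (push p c []), v)"
    by (simp add: hd_opt_def)
  then show ?case by (rule reaches_step[OF _ reaches_refl])
next
  case (Cons d s)
  show ?case
  proof (cases "d \<noteq> inv_letter c \<and> p d c \<noteq> None")
    case False
    then have "machine_step (stack_rule p f) (map Inr (d # s), Inr c # v) = (map Inr (push p c (d # s)), v)"
      by (auto simp: hd_opt_def split: option.splits)
    then show ?thesis by (rule reaches_step[OF _ reaches_refl])
  next
    case True
    then obtain c' where c': "p d c = Some c'" by blast
    let ?s' = "push p c' s"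
    have irr: "irreducible p s" using irreducible_ConsD[OF Cons.prems] .
    have "irreducible p (d # ?s')"
      by (intro irreducible_Cons_push[OF Cons.prems c'] irreducible_push irr)
    then have "machine_step (stack_rule p f) (map Inr ?s', Inr d # v) = (map Inr (d # ?s'), v)"
      by (cases ?s') (auto simp: hd_opt_def)
    then have "reaches (machine_step (stack_rule p f)) (map Inr ?s', Inr d # v) (map Inr (d # ?s'), v)"
      by (rule reaches_step[OF _ reaches_refl])
    then have reach: "reaches (machine_step (stack_rule p f)) (map Inr s, Inr c' # Inr d # v) (map Inr (d # ?s'), v)"
      by (rule reaches_trans[OF Cons.IH[OF irr]])
    have "machine_step (stack_rule p f) (map Inr (d # s), Inr c # v) = (map Inr s, Inr c' # Inr d # v)"
      using True c' by (simp add: hd_opt_def)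
    from reaches_step[OF this reach] show ?thesis using True c' by simp
  qed
qed

lemma reaches_fold_push:
  assumes "irreducible p s"
  shows "reaches (machine_step (stack_rule p f)) (map Inr s, map Inr z @ v) (map Inr (fold (push p) z s), v)"
  using assms
proof (induction z arbitrary: s)
  case (Cons c z)
  have "reaches (machine_step (stack_rule p f)) (map Inr s, Inr c # map Inr z @ v) (map Inr (push p c s), map Inr z @ v)"
    by (rule reaches_push[OF Cons.prems])
  from reaches_trans[OF this Cons.IH[OF irreducible_push[OF Cons.prems]]] show ?case by simp
qed (simp add: reaches_refl)

text \<open>Inputs may mix tagged and expanded letters, because \<open>machine_decides\<close> asks
  for halting on every list over the common alphabet.\<close>

lemma reaches_expand:
  assumes "irreducible p s"
  shows "reaches (machine_step (stack_rule p f)) (map Inr s, v)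
    (map Inr (fold (push p) (concat (map (case_sum f (\<lambda>c. [c])) v)) s), [])"
  using assms
proof (induction v arbitrary: s)
  case (Cons x v)
  let ?z = "case_sum f (\<lambda>c. [c]) x"
  have "reaches (machine_step (stack_rule p f)) (map Inr s, x # v) (map Inr (fold (push p) ?z s), v)"
  proof (cases x)
    case (Inl b)
    then have "machine_step (stack_rule p f) (map Inr s, x # v) = (map Inr s, map Inr (f b) @ v)"
      by (cases s) (auto simp: hd_opt_def)
    from reaches_step[OF this reaches_fold_push[OF Cons.prems]] show ?thesis using Inl by simp
  next
    case (Inr c)
    then show ?thesis using reaches_push[OF Cons.prems] by simp
  qed
  from reaches_trans[OF this Cons.IH[OF irreducible_fold_push[OF Cons.prems]]] show ?case by simp
qed (simp add: reaches_refl)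

end

lemma stack_rule_lists:
  assumes "\<And>x. x \<in> \<Sigma> \<Longrightarrow> f x \<in> lists \<Gamma>" "\<And>e c c'. p e c = Some c' \<Longrightarrow> c' \<in> \<Gamma>"
    and "x \<in> Inl ` \<Sigma> \<union> Inr ` \<Gamma>" "d \<in> insert None (Some ` (Inl ` \<Sigma> \<union> Inr ` \<Gamma>))"
  shows "fst (stack_rule p f x d) \<in> lists (Inl ` \<Sigma> \<union> Inr ` \<Gamma>) \<and> snd (stack_rule p f x d) \<in> lists (Inl ` \<Sigma> \<union> Inr ` \<Gamma>)"
proof (cases x)
  case (Inl b)
  then show ?thesis using assms(1)[of b] assms(3,4) by auto
next
  case (Inr c)
  then have "c \<in> \<Gamma>" using assms(3) by auto
  moreover have "c' \<in> \<Gamma>" if "p e c = Some c'" for e c' using assms(2) that .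
  ultimately show ?thesis using Inr assms(4)
    by (auto split: option.splits if_splits)
qed

lemma (in passing) decidable_language_normal_form:
  assumes "finite \<Sigma>" "finite \<Gamma>" "L \<subseteq> \<Gamma>"
    and "\<And>x. x \<in> \<Sigma> \<Longrightarrow> f x \<in> lists \<Gamma>" "\<And>e c c'. p e c = Some c' \<Longrightarrow> c' \<in> \<Gamma>"
  shows "decidable_language \<Sigma> {w \<in> lists \<Sigma>. fold (push p) (concat (map f w)) [] \<in> lists L}"
  unfolding decidable_language_def
proof (intro conjI allI impI)
  fix c :: "'b \<Rightarrow> nat" assume c: "inj_on c \<Sigma>"
  obtain e0 :: "'a letter \<Rightarrow> nat" where e0: "inj_on e0 \<Gamma>"
    using finite_imp_inj_to_nat_seg[OF assms(2)] by blast
  obtain N where N: "\<forall>l\<in>c ` \<Sigma>. l < N"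
    using assms(1) finite_nat_set_iff_bounded by blast
  \<comment> \<open>The numbering \<open>c\<close> of the input letters is prescribed; working
    letters get numbers from \<open>N\<close> on, beyond the values of \<open>c\<close> on
    \<open>\<Sigma>\<close>, so codes of input words are unchanged.\<close>
  define e where "e = case_sum c (\<lambda>g. N + e0 g)"
  define S where "S = Inl ` \<Sigma> \<union> Inr ` \<Gamma>"
  have "c x \<noteq> N + e0 g" if "x \<in> \<Sigma>" for x g
    using N that by (metis imageI not_add_less1)
  then have disjoint: "c ` \<Sigma> \<inter> (\<lambda>g. N + e0 g) ` \<Gamma> = {}" by blast
  have "inj_on e (Inl ` \<Sigma>)" "inj_on e (Inr ` \<Gamma>)"
    using c e0 by (auto simp: e_def inj_on_def)
  moreover have "e ` Inl ` \<Sigma> \<inter> e ` Inr ` \<Gamma> = {}" using disjoint by (simp add: e_def image_image)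
  ultimately have inj: "inj_on e S" unfolding S_def inj_on_Un by blast
  define r where "r v = (map Inr (fold (push p) (concat (map (case_sum f (\<lambda>c. [c])) v)) []) :: ('b + 'a letter) list)" for v
  have fin: "finite S" and L: "Inr ` L \<subseteq> S" using assms(1-3) by (auto simp: S_def)
  have closed: "fst (stack_rule p f x d) \<in> lists S \<and> snd (stack_rule p f x d) \<in> lists S"
    if "x \<in> S" "d \<in> insert None (Some ` S)" for x d
    using that unfolding S_def by (rule stack_rule_lists[rotated 2]) (fact assms(4,5))+
  have result: "reaches (machine_step (stack_rule p f)) ([], v) (r v, [])" for v
    using reaches_expand[of "[]" f v] by (simp add: r_def)
  obtain F where F: "recfn 1 F" "\<forall>v\<in>lists S. F [list_encode (map e v)] =
      (if r v \<in> lists (Inr ` L) then 1 else 0)"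
    using machine_decides[OF fin inj L closed result] by blast
  have "F [list_encode (map c w)] =
      (if w \<in> {w \<in> lists \<Sigma>. fold (push p) (concat (map f w)) [] \<in> lists L} then 1 else 0)"
    if "w \<in> lists \<Sigma>" for w
  proof -
    have "map Inl w \<in> lists S" using that by (auto simp: S_def)
    moreover have "e \<circ> Inl = c" by (simp add: fun_eq_iff e_def)
    moreover have "r (map Inl w) = map Inr (fold (push p) (concat (map f w)) [])"
      by (simp add: r_def o_def)
    moreover have "(map Inr z :: ('b + 'a letter) list) \<in> lists (Inr ` L) \<longleftrightarrow> z \<in> lists L" for z
      by (auto simp: in_lists_conv_set)
    ultimately show ?thesis using bspec[OF F(2), of "map Inl w"] that by simp
  qed
  then show "\<exists>F. recfn 1 F \<and> (\<forall>w\<in>lists \<Sigma>. F [list_encode (map c w)] =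
      (if w \<in> {w \<in> lists \<Sigma>. fold (push p) (concat (map f w)) [] \<in> lists L} then 1 else 0))"
    using F(1) by blast
qed (fact assms(1))

section \<open>HNN extensions of free groups along basis letters\<close>

definition flat :: "'x word word \<Rightarrow> 'x word" where
  "flat z = concat (map (\<lambda>(u, b). if b then u else inv_word u) z)"

lemma flat_Nil [simp]: "flat [] = []"
  by (simp add: flat_def)

lemma flat_Cons: "flat (c # z) = flat [c] @ flat z"
  by (simp add: flat_def)

lemma flat_append [simp]: "flat (y @ z) = flat y @ flat z"
  by (simp add: flat_def)

lemma flat_letter: "flat [(u, True)] = u" "flat [(u, False)] = inv_word u"
  by (simp_all add: flat_def)

lemma flat_inv_letter: "flat [inv_letter c] = inv_word (flat [c])"
  by (cases c) (simp add: flat_def inv_letter_def)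

lemma flat_inv_word: "flat (inv_word z) = inv_word (flat z)"
proof (induction z)
  case (Cons c z)
  have "inv_word (flat (c # z)) = inv_word (flat z) @ inv_word (flat [c])"
    by (subst flat_Cons) (simp add: inv_word_append)
  then show ?case using Cons by (simp add: inv_word_Cons flat_inv_letter)
qed simp

lemma flat_letter_words: "c \<in> letters V \<Longrightarrow> V \<subseteq> words X \<Longrightarrow> flat [c] \<in> words X"
  using inv_word_words[of "fst c" X]
  by (cases c) (auto simp: letters_def flat_def simp del: in_lists_conv_set)

lemma flat_words: "z \<in> lists (letters V) \<Longrightarrow> V \<subseteq> words X \<Longrightarrow> flat z \<in> words X"
proof (induction z)
  case (Cons c z)
  then have "flat [c] \<in> words X" "flat z \<in> words X"
    using flat_letter_words[of c V X] by auto
  then show ?case by (subst flat_Cons) simp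
qed simp

lemma letters_mono: "X \<subseteq> Y \<Longrightarrow> letters X \<subseteq> letters Y"
  by (auto simp: letters_def)

lemma words_mono: "X \<subseteq> Y \<Longrightarrow> words X \<subseteq> words Y"
  by (intro lists_mono letters_mono)

lemma bar_letter: "v \<in> bar U \<Longrightarrow> \<exists>c\<in>letters U. flat [c] = v"
  unfolding bar_def letters_def using flat_letter by (metis (no_types, lifting) SigmaI UNIV_I UnE imageE)

lemma inv_word_bar: "v \<in> bar V \<Longrightarrow> inv_word v \<in> bar V"
  by (auto simp: bar_def)

lemma bar_subset: "V \<subseteq> bar U \<Longrightarrow> bar V \<subseteq> bar U"
  by (auto simp: bar_def)

lemma not_reduced_split: "\<not> reduced z \<Longrightarrow> \<exists>x l y. z = x @ [l, inv_letter l] @ y"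
proof (induction z)
  case (Cons k z)
  show ?case
  proof (cases "reduced z")
    case False
    then show ?thesis using Cons.IH by (metis append_Cons)
  next
    case True
    then obtain z' where "z = inv_letter k # z'"
      using Cons.prems by (cases z) (auto simp: reduced_def)
    then show ?thesis by (metis append_Cons append_Nil)
  qed
qed (simp add: reduced_def)

lemma gp_class_closed: "w \<in> words X \<Longrightarrow> gp_class X R w \<in> carrier (Gp X R)"
  by (simp add: Gp_def)

lemma gp_one: "\<one>\<^bsub>Gp X R\<^esub> = gp_class X R []"
  by (simp add: Gp_def)

lemma gp_inv_class:
  assumes "w \<in> words X"
  shows "inv\<^bsub>Gp X R\<^esub> gp_class X R w = gp_class X R (inv_word w)"
proof (rule group.inv_equality[OF group_Gp])
  show "gp_class X R (inv_word w) \<otimes>\<^bsub>Gp X R\<^esub> gp_class X R w = \<one>\<^bsub>Gp X R\<^esub>"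
    using assms inv_word_words[OF assms] inv_word_cancel[OF assms]
    by (simp add: gp_mult_class gp_one gp_class_eq_iff)
qed (use assms inv_word_words[OF assms] in \<open>simp_all add: gp_class_closed\<close>)

lemma word_value_gp_class:
  assumes "V \<subseteq> words X" "z \<in> lists (letters V)"
  shows "word_value (Gp X R) (map (map_prod (gp_class X R) id) z) = gp_class X R (flat z)"
  using assms(2)
proof (induction z)
  case Nil
  then show ?case by (simp add: word_value_def gp_one)
next
  case (Cons c z)
  obtain u b where c: "c = (u, b)" by (cases c)
  have "u \<in> words X" using Cons c assms(1) by (auto simp: letters_def)
  then have "(if b then gp_class X R u else inv\<^bsub>Gp X R\<^esub> gp_class X R u) = gp_class X R (flat [c])"
    by (simp add: c flat_def gp_inv_class)
  moreover have "flat [c] \<in> words X" "flat z \<in> words X"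
    using Cons assms(1) flat_letter_words flat_words by (metis listsE)+
  ultimately show ?case using Cons.IH
    by (subst flat_Cons) (simp add: word_value_def c gp_mult_class id_def del: in_lists_conv_set)
qed

section \<open>The free base group and its basis letters\<close>

locale free_hnn =
  fixes X :: "'x set" and R :: "('x word \<times> 'x word) set" and t :: 'x
    and U U_A U_B :: "'x word set" and A B :: "'x word set set"
    and \<phi> :: "'x word set \<Rightarrow> 'x word set"
  assumes finite_X: "finite X" and R_words: "R \<subseteq> words X \<times> words X" and t: "t \<notin> X"
    and basis: "free_basis_words X R U"
    and iso: "\<phi> \<in> iso (Gp X R\<lparr>carrier := A\<rparr>) (Gp X R\<lparr>carrier := B\<rparr>)"
    and U_A: "U_A \<subseteq> bar U" and U_B: "U_B \<subseteq> bar U"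
    and A: "A = generate (Gp X R) (gp_class X R ` U_A)"
    and B: "B = generate (Gp X R) (gp_class X R ` U_B)"
    and phi_bar: "\<phi> ` gp_class X R ` bar U_A = gp_class X R ` bar U_B"
begin

abbreviation "H \<equiv> Gp X R"
abbreviation "cls \<equiv> gp_class X R"
abbreviation "cl c \<equiv> cls (flat [c])"

sublocale H: group H by (rule group_Gp)

lemma U_words: "U \<subseteq> words X"
  and inj_cls: "inj_on cls U"
  and free: "freely_generates H (cls ` U)"
  using basis by (auto simp: free_basis_words_def)

lemma flat_U: "z \<in> lists (letters U) \<Longrightarrow> flat z \<in> words X"
  by (rule flat_words[OF _ U_words])

lemma flat_U1: "c \<in> letters U \<Longrightarrow> flat [c] \<in> words X"
  by (rule flat_letter_words[OF _ U_words])

lemma cl_inv: "c \<in> letters U \<Longrightarrow> cl (inv_letter c) = inv\<^bsub>H\<^esub> cl c"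
  by (simp add: flat_inv_letter gp_inv_class flat_U1)

lemma cls_flat_append:
  "y \<in> lists (letters U) \<Longrightarrow> z \<in> lists (letters U) \<Longrightarrow> cls (flat (y @ z)) = cls (flat y) \<otimes>\<^bsub>H\<^esub> cls (flat z)"
  by (simp add: gp_mult_class flat_U del: in_lists_conv_set)

lemma bar_U_words: "bar U \<subseteq> words X"
  using U_words inv_word_words unfolding bar_def by blast

text \<open>Freeness speaks of words in the classes of basis words; injectivity of
  \<open>cls\<close> on \<open>U\<close> keeps a word reduced when its letters are replaced by their
  classes.\<close>

lemma trivial_not_reduced:
  assumes "z \<in> lists (letters U)" "cls (flat z) = cls []" "z \<noteq> []"
  shows "\<not> reduced z"
proof
  assume red: "reduced z"
  let ?w = "map (map_prod cls id) z"
  have "reduced ?w"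
    unfolding reduced_def successively_map
  proof (rule successively_mono[OF red[unfolded reduced_def]])
    fix k l assume "k \<in> set z" "l \<in> set z" "l \<noteq> inv_letter k"
    moreover from this have "fst k \<in> U" "fst l \<in> U" using assms(1) by (auto simp: letters_def mem_Times_iff)
    ultimately show "map_prod cls id l \<noteq> inv_letter (map_prod cls id k)"
      using inj_onD[OF inj_cls, of "fst l" "fst k"] by (auto simp: inv_letter_def prod_eq_iff)
  qed
  moreover have "?w \<in> words (cls ` U)" "?w \<noteq> []"
    using assms by (force simp: letters_def)+
  ultimately have "word_value H ?w \<noteq> \<one>\<^bsub>H\<^esub>"
    using free unfolding freely_generates_def by blast
  then show False using word_value_gp_class[OF U_words assms(1)] assms(2) by (simp add: gp_one)
qed

text \<open>Distinct letters of equal class, inverse letters included, would make the reduced word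
  \<open>[c, inv_letter d]\<close> trivial.\<close>

lemma cl_inj: "inj_on cl (letters U)"
proof (rule inj_onI, rule ccontr)
  fix c d assume cd: "c \<in> letters U" "d \<in> letters U" "cl c = cl d" "c \<noteq> d"
  have "cls (flat ([c] @ [inv_letter d])) = \<one>\<^bsub>H\<^esub>"
    using cd by (subst cls_flat_append) (simp_all add: cl_inv gp_class_closed flat_U1)
  then have "\<not> reduced [c, inv_letter d]"
    using cd trivial_not_reduced[of "[c, inv_letter d]"] by (simp add: gp_one)
  then show False using cd by (auto simp: reduced_def)
qed

text \<open>Used with \<open>U_A\<close> to write elements of \<open>A\<close> in letters that
  \<open>\<phi>\<close> sends to letters, and with \<open>U\<close> itself to express the letters of
  \<open>X\<close>.\<close>

lemma generate_words:
  assumes "V \<subseteq> bar U" "h \<in> generate H (cls ` V)"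
  shows "\<exists>z\<in>lists {c \<in> letters U. cl c \<in> cls ` bar V}. cls (flat z) = h"
  using assms(2)
proof (induction rule: generate.induct)
  case one
  show ?case by (intro bexI[of _ "[]"]) (simp_all add: gp_one)
next
  case (incl h)
  then obtain v where v: "v \<in> V" "h = cls v" by blast
  then obtain c where "c \<in> letters U" "flat [c] = v" using assms(1) bar_letter by blast
  then show ?case using v by (intro bexI[of _ "[c]"]) (auto simp: bar_def)
next
  case (inv h)
  then obtain v where v: "v \<in> V" "h = cls v" by blast
  then obtain c where c: "c \<in> letters U" "flat [c] = v" using assms(1) bar_letter by blast
  have "cl (inv_letter c) = inv\<^bsub>H\<^esub> h" using cl_inv[OF c(1)] c v by simp
  moreover have "cl (inv_letter c) \<in> cls ` bar V" using c v by (auto simp: bar_def flat_inv_letter)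
  ultimately show ?case using c by (intro bexI[of _ "[inv_letter c]"]) auto
next
  case (eng h1 h2)
  then obtain z1 z2 where "z1 \<in> lists {c \<in> letters U. cl c \<in> cls ` bar V}" "cls (flat z1) = h1"
    "z2 \<in> lists {c \<in> letters U. cl c \<in> cls ` bar V}" "cls (flat z2) = h2" by blast
  moreover from this have "z1 \<in> lists (letters U)" "z2 \<in> lists (letters U)" by auto
  ultimately show ?case using cls_flat_append[of z1 z2] by (intro bexI[of _ "z1 @ z2"]) auto
qed

section \<open>The associated subgroups and the isomorphism between them\<close>

lemma cls_bar_A: "v \<in> bar U_A \<Longrightarrow> cls v \<in> A"
proof -
  assume v: "v \<in> bar U_A"
  show "cls v \<in> A"
  proof (cases "v \<in> U_A")
    case False
    then obtain u where u: "u \<in> U_A" "v = inv_word u" using v by (auto simp: bar_def)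
    then have "u \<in> words X" using U_A bar_U_words by blast
    then have "cls v = inv\<^bsub>H\<^esub> cls u" using u by (simp add: gp_inv_class)
    then show ?thesis using u A generate.inv[of "cls u" "cls ` U_A" H] by auto
  qed (auto simp: A intro: generate.incl)
qed

lemma A_carrier: "A \<subseteq> carrier H" and B_carrier: "B \<subseteq> carrier H"
proof -
  have "cls ` U_A \<subseteq> carrier H" "cls ` U_B \<subseteq> carrier H"
    using U_A U_B bar_U_words by (auto intro!: gp_class_closed simp del: in_lists_conv_set)
  then show "A \<subseteq> carrier H" "B \<subseteq> carrier H"
    unfolding A B by (auto dest: H.generate_in_carrier)
qed

lemma phi_bij: "bij_betw \<phi> A B"
  and phi_mult: "a \<in> A \<Longrightarrow> b \<in> A \<Longrightarrow> \<phi> (a \<otimes>\<^bsub>H\<^esub> b) = \<phi> a \<otimes>\<^bsub>H\<^esub> \<phi> b"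
  using iso by (auto simp: iso_def hom_def)

lemma one_A: "\<one>\<^bsub>H\<^esub> \<in> A"
  by (simp add: A generate.one)

lemma phi_carrier: "a \<in> A \<Longrightarrow> \<phi> a \<in> carrier H"
  using phi_bij B_carrier bij_betwE by blast

lemma phi_one: "\<phi> \<one>\<^bsub>H\<^esub> = \<one>\<^bsub>H\<^esub>"
  using phi_mult[OF one_A one_A] phi_carrier[OF one_A] by simp

lemma inv_A: "a \<in> A \<Longrightarrow> inv\<^bsub>H\<^esub> a \<in> A"
  using A H.generate_m_inv_closed[of "cls ` U_A" a] U_A bar_U_words
  by (auto intro!: gp_class_closed simp del: in_lists_conv_set)

lemma phi_inv: "a \<in> A \<Longrightarrow> \<phi> (inv\<^bsub>H\<^esub> a) = inv\<^bsub>H\<^esub> \<phi> a"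
  using phi_mult[OF inv_A, of a a] A_carrier phi_one phi_carrier inv_A
  by (intro H.inv_equality[symmetric]) (auto simp: subset_iff)

text \<open>The graph of \<open>\<phi>\<close> on basis letters. As a relation it can be read in
  both directions, as the two rules for the stable letter require.\<close>

definition matches :: "'x word letter \<Rightarrow> 'x word letter \<Rightarrow> bool" where
  "matches c d \<longleftrightarrow> c \<in> letters U \<and> d \<in> letters U \<and> cl c \<in> cls ` bar U_A \<and> \<phi> (cl c) = cl d"

lemma matches_A: "matches c d \<Longrightarrow> cl c \<in> A"
  using cls_bar_A by (auto simp: matches_def)

lemma matches_inj: "matches c d \<Longrightarrow> matches c d' \<Longrightarrow> d = d'" "matches c d \<Longrightarrow> matches c' d \<Longrightarrow> c = c'"
  using cl_inj phi_bij matches_A unfolding matches_def bij_betw_def inj_on_def by metis+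

lemma matches_inv: "matches c d \<Longrightarrow> matches (inv_letter c) (inv_letter d)"
proof -
  assume m: "matches c d"
  then obtain v where "v \<in> bar U_A" "cl c = cls v" by (auto simp: matches_def)
  moreover from this have "v \<in> words X" using bar_subset[OF U_A] bar_U_words by blast
  ultimately have "inv\<^bsub>H\<^esub> cl c \<in> cls ` bar U_A" by (auto simp: gp_inv_class inv_word_bar)
  then show ?thesis using m matches_A[OF m] by (auto simp: matches_def cl_inv phi_inv)
qed

text \<open>Here \<open>phi_bar\<close> enters: the image is the class of a word in
  \<open>bar U_B\<close>, hence in \<open>bar U\<close>, and so of a single letter.\<close>

lemma ex_matches: "c \<in> letters U \<Longrightarrow> cl c \<in> cls ` bar U_A \<Longrightarrow> \<exists>d. matches c d"
proof -
  assume c: "c \<in> letters U" "cl c \<in> cls ` bar U_A"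
  then have "\<phi> (cl c) \<in> cls ` bar U_B" using phi_bar by blast
  moreover have "bar U_B \<subseteq> bar U" by (rule bar_subset[OF U_B])
  ultimately obtain v where "v \<in> bar U" "\<phi> (cl c) = cls v" by blast
  moreover from this obtain d where "d \<in> letters U" "flat [d] = v" using bar_letter by blast
  ultimately show ?thesis using c unfolding matches_def by blast
qed

lemma matches_words:
  "list_all2 matches y z \<Longrightarrow> y \<in> lists (letters U) \<and> z \<in> lists (letters U) \<and> cls (flat y) \<in> A \<and> \<phi> (cls (flat y)) = cls (flat z)"
proof (induction rule: list_all2_induct)
  case Nil
  then show ?case using one_A phi_one by (simp add: gp_one)
next
  case (Cons c y d z)
  then have "c \<in> letters U" "d \<in> letters U" by (auto simp: matches_def)
  moreover have "cl c \<otimes>\<^bsub>H\<^esub> cls (flat y) \<in> A"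
    using matches_A[OF Cons(1)] Cons(3) by (simp add: A generate.eng)
  ultimately show ?case
    using cls_flat_append[of "[c]" y] cls_flat_append[of "[d]" z] Cons matches_A[OF Cons(1)]
      phi_mult[of "cl c" "cls (flat y)"] unfolding matches_def by auto
qed

text \<open>Normal forms are words over basis elements, which are themselves words in \<open>X\<close>; taking the one-letter
  word \<open>t\<close> as a further such symbol gives the stable letter the same type.\<close>

definition \<tau> :: "'x word" where "\<tau> = [(t, True)]"

lemma tau_U: "\<tau> \<notin> U"
  using U_words t by (auto simp: \<tau>_def letters_def)

definition passes :: "'x word letter \<Rightarrow> 'x word letter \<Rightarrow> 'x word letter \<Rightarrow> bool" where
  "passes e c d \<longleftrightarrow> e = (\<tau>, False) \<and> matches c d \<or> e = (\<tau>, True) \<and> matches d c"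

definition pass :: "'x word letter \<Rightarrow> 'x word letter \<Rightarrow> 'x word letter option" where
  "pass e c = (if \<exists>d. passes e c d then Some (THE d. passes e c d) else None)"

lemma pass_iff: "pass e c = Some d \<longleftrightarrow> passes e c d"
proof -
  \<comment> \<open>Through \<open>matches_inj\<close>, \<open>cl_inj\<close> and the injectivity of
    \<open>\<phi>\<close> on \<open>A\<close> make the exchanged letter unique.\<close>
  have "(THE d. passes e c d) = d" if "passes e c d" for d
    using that matches_inj unfolding passes_def by (intro the_equality) blast+
  then show ?thesis unfolding pass_def by (metis option.distinct(1) option.inject)
qed

sublocale passing pass "letters {\<tau>}"
proof
  fix e c c' assume p: "pass e c = Some c'"
  show "pass (inv_letter e) c' = Some c" using p by (auto simp: pass_iff passes_def inv_letter_def)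
  show "pass e (inv_letter c) = Some (inv_letter c')" using p matches_inv unfolding pass_iff passes_def by blast
  have "c \<in> letters U" "c' \<in> letters U" using p by (auto simp: pass_iff passes_def matches_def)
  then show "e \<in> letters {\<tau>} \<and> c \<notin> letters {\<tau>} \<and> c' \<notin> letters {\<tau>}"
    using p tau_U by (auto simp: pass_iff passes_def letters_def)
qed simp

section \<open>The action on irreducible words\<close>

abbreviation "act z s \<equiv> fold (push pass) z s"

text \<open>By freeness a nonempty trivial word contains a cancelling pair; deleting it changes
  neither the class nor, by \<open>push_inv_push\<close>, the action.\<close>

lemma act_trivial:
  "z \<in> lists (letters U) \<Longrightarrow> cls (flat z) = cls [] \<Longrightarrow> irreducible pass s \<Longrightarrow> act z s = s"
proof (induction z rule: length_induct)
  case (1 z)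
  show ?case
  proof (cases "z = []")
    case False
    then obtain x l y where z: "z = x @ [l, inv_letter l] @ y"
      using not_reduced_split trivial_not_reduced "1.prems" by blast
    then have U: "x \<in> lists (letters U)" "y \<in> lists (letters U)" "l \<in> letters U" using "1.prems" by auto
    have "cl l \<otimes>\<^bsub>H\<^esub> (cl (inv_letter l) \<otimes>\<^bsub>H\<^esub> cls (flat y)) = cls (flat y)"
      using U by (simp add: cl_inv H.m_assoc[symmetric] gp_class_closed flat_U flat_U1 del: in_lists_conv_set)
    moreover have "cls (flat ([inv_letter l] @ y)) = cl (inv_letter l) \<otimes>\<^bsub>H\<^esub> cls (flat y)"
      "cls (flat ([l] @ [inv_letter l] @ y)) = cl l \<otimes>\<^bsub>H\<^esub> cls (flat ([inv_letter l] @ y))"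
      using U by (intro cls_flat_append; simp)+
    ultimately have "cls (flat (x @ y)) = cls (flat z)"
      using U z cls_flat_append[of x y] cls_flat_append[of x "[l] @ [inv_letter l] @ y"] by simp
    then have "cls (flat (x @ y)) = cls []" using "1.prems"(2) by simp
    moreover have "length (x @ y) < length z" "x @ y \<in> lists (letters U)" using U z by simp_all
    ultimately have "act (x @ y) s = s" using "1.IH" "1.prems"(3) by blast
    then show ?thesis using z "1.prems"(3) by (simp add: push_inv_push irreducible_fold_push)
  qed simp
qed

text \<open>\<open>y\<close> followed by the inverse of \<open>z\<close> acts trivially, so the
  inverse of \<open>z\<close> undoes the action of \<open>y\<close>; inverting once more gives the
  action of \<open>z\<close>.\<close>

lemma act_cong:
  assumes "y \<in> lists (letters U)" "z \<in> lists (letters U)" "cls (flat y) = cls (flat z)" "irreducible pass s"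
  shows "act y s = act z s"
proof -
  have iz: "inv_word z \<in> lists (letters U)" using assms(2) by (rule inv_word_words)
  have "cls (flat (y @ inv_word z)) = \<one>\<^bsub>H\<^esub>"
    using assms iz by (subst cls_flat_append)
      (simp_all add: flat_inv_word gp_inv_class[symmetric] flat_U gp_class_closed del: in_lists_conv_set)
  then have "act (inv_word z) (act y s) = s"
    using act_trivial[of "y @ inv_word z" s] assms iz by (simp add: gp_one)
  then have "act (inv_word (inv_word z)) s = act y s"
    using fold_push_inv_word[OF irreducible_fold_push[OF assms(4), of y], of "inv_word z"] by simp
  then show ?thesis by simp
qed

text \<open>The choice need not be effective: there are only finitely many letters, and the chosen
  words become part of the transition table.\<close>

definition expand :: "'x letter \<Rightarrow> 'x word word" where
  "expand l = (if fst l = t then [(\<tau>, snd l)]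
     else SOME z. z \<in> lists (letters U) \<and> cls (flat z) = cls [l])"

lemma expand:
  assumes "l \<in> letters X"
  shows "expand l \<in> lists (letters U)" "cls (flat (expand l)) = cls [l]"
proof -
  have "cls [l] \<in> generate H (cls ` U)"
    using assms free by (simp add: freely_generates_def gp_class_closed)
  then obtain z where "z \<in> lists (letters U)" "cls (flat z) = cls [l]"
    using generate_words[of U] by (fastforce simp: bar_def)
  then have "\<exists>z. z \<in> lists (letters U) \<and> cls (flat z) = cls [l]" by blast
  from someI_ex[OF this] show "expand l \<in> lists (letters U)" "cls (flat (expand l)) = cls [l]"
    using assms t by (auto simp: expand_def letters_def)
qed

abbreviation "expands w \<equiv> concat (map expand w)"

lemma expands:
  "w \<in> words X \<Longrightarrow> expands w \<in> lists (letters U) \<and> cls (flat (expands w)) = cls w"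
proof (induction w)
  case (Cons l w)
  then show ?case using expand[of l] cls_flat_append[of "expand l" "expands w"] gp_mult_class[of "[l]" X w R]
    by simp
qed simp

abbreviation "G \<equiv> HNN X R t A \<phi>"
abbreviation "gcls \<equiv> hnn_class X R t A \<phi>"

sublocale G: group G
  unfolding HNN_def by (rule group_Gp)

lemma gcls_eq_iff: "w \<in> words (insert t X) \<Longrightarrow>
    gcls w = gcls w' \<longleftrightarrow> gp_eq (insert t X) (hnn_relations R t A \<phi>) w w'"
  by (rule gp_class_eq_iff)

text \<open>By the van der Waerden trick, this invariance shows that the normal form of a word depends only on
  the element of the HNN extension.\<close>

lemma act_expands_cong:
  assumes "gp_eq (insert t X) (hnn_relations R t A \<phi>) w w'"
  shows "irreducible pass s \<Longrightarrow> act (expands w) s = act (expands w') s"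
  using assms
proof (induction arbitrary: s rule: gp_eq.induct)
  case (rel u v)
  show ?case
  proof (cases "(u, v) \<in> R")
    case True
    then have "u \<in> words X" "v \<in> words X" using R_words by blast+
    moreover from this have "gp_eq X R u v" using True gp_eq.rel by blast
    ultimately have "u \<in> words X" "v \<in> words X" "cls u = cls v" by (simp_all only: gp_class_eq_iff)
    then show ?thesis
      using expands[of u] expands[of v] rel.prems by (intro act_cong) auto
  next
    case False
    then obtain a u' where a: "a \<in> A" "u' \<in> a" "v \<in> \<phi> a" and u: "u = [(t, False)] @ u' @ [(t, True)]"
      using rel by (auto simp: hnn_relations_def)
    \<comment> \<open>\<open>a\<close> is written in basis letters of \<open>A\<close>, so that
      \<open>\<phi>\<close> can be applied letter by letter and \<open>map f y\<close> represents
      \<open>\<phi> a\<close>.\<close>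
    obtain y where y: "y \<in> lists {c \<in> letters U. cl c \<in> cls ` bar U_A}" "cls (flat y) = a"
      using generate_words[OF U_A] a(1) A by blast
    then have "\<forall>c\<in>set y. \<exists>d. matches c d" using ex_matches by auto
    then obtain f where "\<forall>c\<in>set y. matches c (f c)" by metis
    then have m: "list_all2 matches y (map f y)"
      by (simp add: list_all2_map2 list_all2_same)
    note z = matches_words[OF m]
    have cls: "cls u' = a" "cls v = \<phi> a" "u' \<in> words X" "v \<in> words X"
    proof -
      have "gp_eq X R (flat y) u'" "gp_eq X R (flat (map f y)) v"
        using a y z by (auto simp: gp_class_def)
      then show "cls u' = a" "cls v = \<phi> a" "u' \<in> words X" "v \<in> words X"
        using y(2) z gp_class_eq_iff[of "flat y" X R u'] gp_class_eq_iff[of "flat (map f y)" X R v]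
          gp_eq_words by (blast, metis, blast, blast)
    qed
    have "list_all2 (\<lambda>c c'. pass (\<tau>, False) c = Some c') y (map f y)"
      using m by (simp add: pass_iff passes_def)
    note pass = fold_push_pass[OF this rel.prems]
    have irr: "irreducible pass (push pass (\<tau>, False) s)" by (rule irreducible_push[OF rel.prems])
    \<comment> \<open>Reading from the left, the inverse stable letter is pushed first,
      \<open>y\<close> passes it and becomes \<open>map f y\<close>, and the final stable letter
      cancels it.\<close>
    have "act (expands u) s = push pass (\<tau>, True) (act (expands u') (push pass (\<tau>, False) s))"
      by (simp add: u expand_def)
    also have "act (expands u') (push pass (\<tau>, False) s) = act y (push pass (\<tau>, False) s)"
      using expands[OF cls(3)] cls(1) y z irr by (intro act_cong) auto
    also have "push pass (\<tau>, True) (act y (push pass (\<tau>, False) s)) = act (map f y) s"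
      unfolding pass using push_inv_push[of "act (map f y) s" "(\<tau>, False)"] irreducible_fold_push[OF rel.prems]
      by (simp add: inv_letter_def)
    also have "\<dots> = act (expands v) s"
      using expands[OF cls(4)] cls(2) y z rel.prems by (intro act_cong) auto
    finally show ?thesis .
  qed
next
  case (cancel l)
  show ?case
  proof (cases "fst l = t")
    case True
    then have "expand l = [(\<tau>, snd l)]" "expand (inv_letter l) = [inv_letter (\<tau>, snd l)]"
      by (simp_all add: expand_def inv_letter_def)
    then show ?thesis using cancel.prems by (simp add: push_inv_push)
  next
    case False
    then have l: "l \<in> letters X" using cancel.hyps by (auto simp: letters_def)
    \<comment> \<open>The expansions of \<open>l\<close> and its inverse are chosen independently
      and need not be formal inverses; their product is only trivial in \<open>H\<close>, which
      suffices for \<open>act_trivial\<close>.\<close>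
    then have "[l, inv_letter l] \<in> words X" by simp
    from expands[OF this] show ?thesis
      using cancel.prems l gp_eq.cancel[OF l, of R] act_trivial[of "expands [l, inv_letter l]" s]
        gp_class_eq_iff[of "[l, inv_letter l]" X R "[]"] by simp
  qed
next
  case (append u v u' v')
  then show ?case using irreducible_fold_push by simp
qed simp_all

section \<open>Normal forms represent the original elements of the HNN extension\<close>

abbreviation "\<Gamma> \<equiv> letters (insert \<tau> U)"
abbreviation "gcl c \<equiv> gcls (flat [c])"

lemma Gamma_words: "insert \<tau> U \<subseteq> words (insert t X)"
  using U_words words_mono[of X "insert t X"] by (auto simp: \<tau>_def letters_def)

lemma flat_Gamma: "z \<in> lists \<Gamma> \<Longrightarrow> flat z \<in> words (insert t X)"
  by (rule flat_words[OF _ Gamma_words])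

lemma gcls_closed: "w \<in> words (insert t X) \<Longrightarrow> gcls w \<in> carrier G"
  unfolding HNN_def by (rule gp_class_closed)

lemma gcls_append:
  "v \<in> words (insert t X) \<Longrightarrow> w \<in> words (insert t X) \<Longrightarrow> gcls (v @ w) = gcls v \<otimes>\<^bsub>G\<^esub> gcls w"
  unfolding HNN_def by (rule gp_mult_class[symmetric])

lemma gcl_inv: "c \<in> \<Gamma> \<Longrightarrow> gcl (inv_letter c) = inv\<^bsub>G\<^esub> gcl c"
  unfolding HNN_def flat_inv_letter
  by (rule gp_inv_class[symmetric]) (rule flat_letter_words[OF _ Gamma_words])

lemma gcl_closed: "c \<in> \<Gamma> \<Longrightarrow> gcl c \<in> carrier G"
  by (rule gcls_closed, rule flat_letter_words[OF _ Gamma_words])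

lemma U_Gamma: "letters U \<subseteq> \<Gamma>" and tau_Gamma: "(\<tau>, b) \<in> \<Gamma>"
  by (auto simp: letters_def)

lemma gcl_conj:
  assumes "matches c d"
  shows "inv\<^bsub>G\<^esub> gcl (\<tau>, True) \<otimes>\<^bsub>G\<^esub> (gcl c \<otimes>\<^bsub>G\<^esub> gcl (\<tau>, True)) = gcl d"
proof -
  have c: "c \<in> letters U" "d \<in> letters U" and "\<phi> (cl c) = cl d"
    using assms by (auto simp: matches_def)
  then have w: "flat [c] \<in> words (insert t X)" "flat [d] \<in> words (insert t X)"
    "[(t, True)] \<in> words (insert t X)" "[(t, False)] \<in> words (insert t X)"
    using flat_Gamma[of "[c]"] flat_Gamma[of "[d]"] U_Gamma by (auto simp: letters_def)
  have "v \<in> cls v" if "v \<in> words X" for v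
    using gp_eq.refl[OF that] by (simp add: gp_class_def)
  then have "flat [c] \<in> cl c" "flat [d] \<in> \<phi> (cl c)"
    using c flat_U1 \<open>\<phi> (cl c) = cl d\<close> by metis+
  then have rel: "([(t, False)] @ flat [c] @ [(t, True)], flat [d]) \<in> hnn_relations R t A \<phi>"
    using matches_A[OF assms] unfolding hnn_relations_def by blast
  have lhs: "[(t, False)] @ flat [c] @ [(t, True)] \<in> words (insert t X)" using w by simp
  have "gcls ([(t, False)] @ flat [c] @ [(t, True)]) = gcls (flat [d])"
    unfolding gcls_eq_iff[OF lhs] by (rule gp_eq.rel[OF rel lhs w(2)])
  moreover have "inv\<^bsub>G\<^esub> gcl (\<tau>, True) = gcls [(t, False)]"
    using gcl_inv[OF tau_Gamma, of True] by (simp add: flat_inv_letter flat_letter \<tau>_def inv_word_def inv_letter_def)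
  moreover have "gcl (\<tau>, True) = gcls [(t, True)]" by (simp add: flat_letter \<tau>_def)
  moreover have "flat [c] @ [(t, True)] \<in> words (insert t X)" using w by simp
  ultimately show ?thesis using w gcls_append by metis
qed

lemma gcl_pass:
  assumes "pass e c = Some d"
  shows "gcl e \<otimes>\<^bsub>G\<^esub> gcl c = gcl d \<otimes>\<^bsub>G\<^esub> gcl e"
proof -
  have "c \<in> letters U" "d \<in> letters U" using assms by (auto simp: pass_iff passes_def matches_def)
  then have cl: "gcl c \<in> carrier G" "gcl d \<in> carrier G" "gcl (\<tau>, True) \<in> carrier G"
    using U_Gamma tau_Gamma gcl_closed by blast+
  have inv: "gcl (\<tau>, False) = inv\<^bsub>G\<^esub> gcl (\<tau>, True)"
    using gcl_inv[OF tau_Gamma, of True] by (simp add: inv_letter_def)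
  from assms consider "e = (\<tau>, False)" "matches c d" | "e = (\<tau>, True)" "matches d c"
    by (auto simp: pass_iff passes_def)
  then show ?thesis
  proof cases
    case 1
    have "gcl d \<otimes>\<^bsub>G\<^esub> inv\<^bsub>G\<^esub> gcl (\<tau>, True) = inv\<^bsub>G\<^esub> gcl (\<tau>, True) \<otimes>\<^bsub>G\<^esub> gcl c"
      unfolding gcl_conj[OF 1(2), symmetric] using cl by (simp add: G.m_assoc)
    then show ?thesis using 1(1) inv by simp
  next
    case 2
    have "gcl (\<tau>, True) \<otimes>\<^bsub>G\<^esub> gcl c = gcl d \<otimes>\<^bsub>G\<^esub> gcl (\<tau>, True)"
      unfolding gcl_conj[OF 2(2), symmetric] using cl by (simp add: G.m_assoc[symmetric])
    then show ?thesis using 2(1) by simp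
  qed
qed

lemma pass_Gamma: "pass e c = Some d \<Longrightarrow> d \<in> \<Gamma>"
  using U_Gamma by (auto simp: pass_iff passes_def matches_def)

lemma act_Gamma: "z \<in> lists \<Gamma> \<Longrightarrow> s \<in> lists \<Gamma> \<Longrightarrow> act z s \<in> lists \<Gamma>"
  by (rule fold_push_lists) (rule pass_Gamma)

lemma gcls_flat_snoc: "z \<in> lists \<Gamma> \<Longrightarrow> c \<in> \<Gamma> \<Longrightarrow> gcls (flat (z @ [c])) = gcls (flat z) \<otimes>\<^bsub>G\<^esub> gcl c"
  unfolding flat_append by (rule gcls_append[OF flat_Gamma flat_Gamma]) simp_all

text \<open>The stack holds the word backwards, hence \<open>rev\<close>. Each case of
  \<open>push\<close> is an identity in the group: cancellation, plain multiplication, or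
  \<open>gcl_pass\<close>.\<close>

lemma gcls_push:
  "c \<in> \<Gamma> \<Longrightarrow> s \<in> lists \<Gamma> \<Longrightarrow> gcls (flat (rev (push pass c s))) = gcls (flat (rev s)) \<otimes>\<^bsub>G\<^esub> gcl c"
proof (induction s arbitrary: c)
  case Nil
  have "gcls (flat ([] @ [c])) = gcls (flat []) \<otimes>\<^bsub>G\<^esub> gcl c"
    by (rule gcls_flat_snoc) (use Nil in simp_all)
  then show ?case by simp
next
  case (Cons d s)
  have s: "rev s \<in> lists \<Gamma>" "d \<in> \<Gamma>" using Cons.prems by auto
  have cl: "gcls (flat (rev s)) \<in> carrier G" "gcl d \<in> carrier G" "gcl c \<in> carrier G"
    using s Cons.prems by (auto intro!: gcls_closed flat_Gamma gcl_closed simp del: in_lists_conv_set)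
  have ds: "gcls (flat (rev (d # s))) = gcls (flat (rev s)) \<otimes>\<^bsub>G\<^esub> gcl d"
    using gcls_flat_snoc[OF s] by simp
  consider "d = inv_letter c" | "d \<noteq> inv_letter c" "pass d c = None" | c' where "d \<noteq> inv_letter c" "pass d c = Some c'"
    by blast
  then show ?case
  proof cases
    case 1
    then have "gcl d = inv\<^bsub>G\<^esub> gcl c" using gcl_inv Cons.prems by blast
    then show ?thesis using ds 1 cl by (simp add: G.m_assoc)
  next
    case 2
    moreover have "rev (d # s) \<in> lists \<Gamma>" using s by simp
    ultimately show ?thesis using gcls_flat_snoc[of "rev (d # s)" c] Cons.prems(1) by simp
  next
    case (3 c')
    then have c': "c' \<in> \<Gamma>" using pass_Gamma by blast
    have "rev (push pass c' s) \<in> lists \<Gamma>" using act_Gamma[of "[c']" s] c' Cons.prems by (simp add: in_lists_conv_set)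
    then have "gcls (flat (rev (push pass c (d # s)))) = gcls (flat (rev (push pass c' s))) \<otimes>\<^bsub>G\<^esub> gcl d"
      using gcls_flat_snoc[OF _ s(2), of "rev (push pass c' s)"] 3 by simp
    also have "\<dots> = gcls (flat (rev s)) \<otimes>\<^bsub>G\<^esub> gcl c' \<otimes>\<^bsub>G\<^esub> gcl d"
      using Cons.IH[OF c'] Cons.prems by simp
    also have "\<dots> = gcls (flat (rev s)) \<otimes>\<^bsub>G\<^esub> gcl d \<otimes>\<^bsub>G\<^esub> gcl c"
      using cl gcl_closed[OF c'] gcl_pass[OF 3(2)] by (simp add: G.m_assoc)
    finally show ?thesis using ds by simp
  qed
qed

lemma gcls_act:
  "z \<in> lists \<Gamma> \<Longrightarrow> s \<in> lists \<Gamma> \<Longrightarrow> gcls (flat (rev (act z s))) = gcls (flat (rev s)) \<otimes>\<^bsub>G\<^esub> gcls (flat z)"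
proof (induction z arbitrary: s)
  case Nil
  then have "gcls (flat (rev s)) \<in> carrier G" by (auto intro!: gcls_closed flat_Gamma)
  moreover have "gcls (flat []) = \<one>\<^bsub>G\<^esub>" by (simp add: HNN_def gp_one)
  ultimately show ?case by simp
next
  case (Cons c z)
  then have c: "c \<in> \<Gamma>" "z \<in> lists \<Gamma>" by auto
  have "push pass c s \<in> lists \<Gamma>" using act_Gamma[of "[c]" s] c Cons.prems by simp
  from Cons.IH[OF c(2) this] have "gcls (flat (rev (act (c # z) s)))
      = gcls (flat (rev s)) \<otimes>\<^bsub>G\<^esub> gcl c \<otimes>\<^bsub>G\<^esub> gcls (flat z)"
    using gcls_push[OF c(1) Cons.prems(2)] by simp
  moreover have "gcls (flat (c # z)) = gcl c \<otimes>\<^bsub>G\<^esub> gcls (flat z)"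
    using c flat_letter_words[OF _ Gamma_words] flat_Gamma by (subst flat_Cons, intro gcls_append)
  moreover have "gcls (flat (rev s)) \<in> carrier G" "gcl c \<in> carrier G" "gcls (flat z) \<in> carrier G"
    using c Cons.prems by (auto intro!: gcls_closed flat_Gamma gcl_closed)
  ultimately show ?case by (simp add: G.m_assoc)
qed

lemma gcls_mono: "v \<in> words X \<Longrightarrow> cls v = cls w \<Longrightarrow> gcls v = gcls w"
  using gp_class_eq_iff[of v X R w] gp_eq_words[of X R v w] by (metis hnn_embed_class)

lemma expand_Gamma: "l \<in> letters (insert t X) \<Longrightarrow> expand l \<in> lists \<Gamma> \<and> gcls (flat (expand l)) = gcls [l]"
proof (cases "fst l = t")
  case True
  then show "expand l \<in> lists \<Gamma> \<and> gcls (flat (expand l)) = gcls [l]"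
    using tau_Gamma by (cases l; cases "snd l") (auto simp: expand_def flat_letter \<tau>_def inv_word_def inv_letter_def)
next
  case False
  assume "l \<in> letters (insert t X)"
  then have l: "l \<in> letters X" using False by (auto simp: letters_def)
  have "gcls [l] = gcls (flat (expand l))"
    using expand[OF l] l by (intro gcls_mono) auto
  then show ?thesis using expand(1)[OF l] U_Gamma by auto
qed

lemma expands_Gamma:
  "w \<in> words (insert t X) \<Longrightarrow> expands w \<in> lists \<Gamma> \<and> gcls (flat (expands w)) = gcls w"
proof (induction w)
  case (Cons l w)
  then have l: "expand l \<in> lists \<Gamma>" "gcls (flat (expand l)) = gcls [l]"
    and w: "expands w \<in> lists \<Gamma>" "gcls (flat (expands w)) = gcls w" using expand_Gamma[of l] by auto
  have "gcls (flat (expand l @ expands w)) = gcls [l] \<otimes>\<^bsub>G\<^esub> gcls w"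
    unfolding flat_append using l w by (simp add: gcls_append flat_Gamma del: in_lists_conv_set)
  also have "\<dots> = gcls (l # w)" using gcls_append[of "[l]" w] Cons.prems by simp
  finally show ?case using l w by simp
qed simp

text \<open>A basis letter spelled out over \<open>X\<close> and expanded again may become another
  word over \<open>U\<close>, but of the same class, so \<open>act_cong\<close> applies; stable
  letters are restored literally.\<close>

lemma act_expands_flat:
  assumes "z \<in> lists \<Gamma>" "irreducible pass s"
  shows "act (expands (flat z)) s = act z s"
  using assms
proof (induction z arbitrary: s rule: list.induct)
  case (Cons c z)
  have "act (expands (flat [c])) s = push pass c s"
  proof (cases "c \<in> letters U")
    case True
    have "act (expands (flat [c])) s = act [c] s"
      using expands[OF flat_U1[OF True]] True Cons.prems by (intro act_cong) auto
    then show ?thesis by simp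
  next
    case False
    moreover have "c \<in> \<Gamma>" using Cons.prems by simp
    ultimately have "fst c = \<tau>" by (auto simp: letters_def mem_Times_iff)
    then show ?thesis
      by (cases c; cases "snd c") (auto simp: flat_letter \<tau>_def expand_def inv_word_def inv_letter_def)
  qed
  then show ?case using Cons irreducible_push by (subst flat_Cons) simp
qed simp

text \<open>A basis letter, rewritten through the expansions of the finitely many letters of \<open>X\<close>, has itself as
  normal form, so it occurs in one of these expansions.\<close>

lemma finite_U: "finite U"
proof -
  define F where "F = (\<Union>l\<in>letters X. set (expand l))"
  have "finite (letters X)" using finite_X by (simp add: letters_def)
  then have "finite F" by (simp add: F_def)
  moreover have "U \<subseteq> fst ` F"
  proof
    fix u assume u: "u \<in> U"
    then have c: "(u, True) \<in> letters U" "(u, True) \<in> \<Gamma>" by (auto simp: letters_def)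
    let ?z = "expands (flat [(u, True)])"
    have w: "flat [(u, True)] \<in> words X" by (rule flat_U1[OF c(1)])
    have z: "?z \<in> lists (letters U)" using expands[OF w] by blast
    have "[(u, True)] = act ?z []"
      using act_expands_flat[of "[(u, True)]" "[]"] c by simp
    \<comment> \<open>No stable letter occurs in \<open>?z\<close>, so only free cancellation takes
      place.\<close>
    moreover have "set (act ?z []) \<subseteq> set ?z"
    proof -
      have "set ?z \<subseteq> letters U" using z unfolding in_lists_conv_set by blast
      moreover have "letters U \<inter> letters {\<tau>} = {}" using tau_U by (auto simp: letters_def)
      ultimately have "set ?z \<inter> letters {\<tau>} = {}" by blast
      then show ?thesis using set_fold_push_stable_free[of "[]" ?z] by simp
    qed
    ultimately have "(u, True) \<in> set ?z" by (metis list.set_intros(1) subsetD)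
    then have "(u, True) \<in> F" using w by (auto simp: F_def)
    then show "u \<in> fst ` F" by force
  qed
  ultimately show ?thesis by (metis finite_imageI finite_subset)
qed

section \<open>Membership in the submonoid \<open>P\<close>\<close>

lemma decidable_monoid:
  assumes U_Q: "U_Q \<subseteq> bar U" and Q: "Q = mon_generate H (cls ` U_Q)"
    and phi_Q: "\<phi> ` (Q \<inter> A) = Q \<inter> B"
    and P: "P = mon_generate G (hnn_embed X R t A \<phi> ` Q \<union> {gcls [(t, True)], gcls [(t, False)]})"
  shows "decidable_membership (insert t X) (hnn_relations R t A \<phi>) P"
proof -
  define L where "L = {c \<in> letters U. cl c \<in> Q} \<union> letters {\<tau>}"
  have L_Gamma: "L \<subseteq> \<Gamma>" using U_Gamma by (auto simp: L_def letters_def)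
  have pass_L: "d \<in> L" if p: "pass e c = Some d" and c: "c \<in> L" for e c d
  proof -
    have m: "matches c d \<or> matches d c" using p by (auto simp: pass_iff passes_def)
    then have U: "c \<in> letters U" "d \<in> letters U" by (auto simp: matches_def)
    then have cQ: "cl c \<in> Q" using c tau_U by (auto simp: L_def letters_def)
    from m have "cl d \<in> Q"
    proof
      assume m: "matches c d"
      then have "\<phi> (cl c) \<in> Q \<inter> B" using cQ matches_A phi_Q by blast
      then show ?thesis using m by (simp add: matches_def)
    next
      assume m: "matches d c"
      have eq: "\<phi> (cl d) = cl c" using m by (simp add: matches_def)
      have dA: "cl d \<in> A" by (rule matches_A[OF m])
      then have "cl c \<in> B" using phi_bij eq bij_betwE by metis
      \<comment> \<open>The element of \<open>Q\<close> obtained here as a preimage of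
        \<open>cl c\<close> must be \<open>cl d\<close>, by injectivity of \<open>\<phi>\<close> on
        \<open>A\<close>.\<close>
      then have "cl c \<in> \<phi> ` (Q \<inter> A)" using cQ phi_Q by blast
      then obtain q where q: "q \<in> Q" "q \<in> A" "\<phi> q = \<phi> (cl d)" using eq by auto
      then have "q = cl d" using phi_bij dA unfolding bij_betw_def by (blast dest: inj_onD)
      then show ?thesis using q(1) by simp
    qed
    then show ?thesis using U by (simp add: L_def)
  qed
  have Q_words: "\<exists>z\<in>lists {c \<in> letters U. cl c \<in> Q}. cls (flat z) = q" if "q \<in> Q" for q
    using that unfolding Q
  proof (induction rule: mon_generate.induct)
    case one
    show ?case by (intro bexI[of _ "[]"]) (simp_all add: gp_one)
  next
    case (incl q)
    then obtain v where "v \<in> U_Q" "q = cls v" by blast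
    moreover from this obtain c where "c \<in> letters U" "flat [c] = v" using U_Q bar_letter by blast
    ultimately show ?case using mon_generate.incl[OF incl] by (intro bexI[of _ "[c]"]) auto
  next
    case (mult q q')
    then obtain z z' where z: "z \<in> lists {c \<in> letters U. cl c \<in> mon_generate H (cls ` U_Q)}" "cls (flat z) = q"
      "z' \<in> lists {c \<in> letters U. cl c \<in> mon_generate H (cls ` U_Q)}" "cls (flat z') = q'" by blast
    moreover from this have "z \<in> lists (letters U)" "z' \<in> lists (letters U)" by auto
    ultimately show ?case using cls_flat_append[of z z'] by (intro bexI[of _ "z @ z'"]) auto
  qed
  have P_words: "\<exists>z\<in>lists L. gcls (flat z) = g" if "g \<in> P" for g
    using that unfolding P
  proof (induction rule: mon_generate.induct)
    case one
    show ?case by (intro bexI[of _ "[]"]) (simp_all add: HNN_def gp_one)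
  next
    case (incl g)
    then consider q where "q \<in> Q" "g = hnn_embed X R t A \<phi> q" | b where "g = gcls [(t, b)]" by blast
    then show ?case
    proof cases
      case 1
      from Q_words[OF 1(1)] obtain z where z: "z \<in> lists {c \<in> letters U. cl c \<in> Q}" "cls (flat z) = q" by blast
      then have "z \<in> lists (letters U)" by auto
      then have "gcls (flat z) = g" using 1(2) z(2) hnn_embed_class[OF flat_U] by metis
      then show ?thesis using z(1) by (intro bexI[of _ z]) (auto simp: L_def)
    next
      case (2 b)
      have "flat [(\<tau>, b)] = [(t, b)]"
        by (cases b) (simp_all add: flat_letter \<tau>_def inv_word_def inv_letter_def)
      then show ?thesis using 2 by (intro bexI[of _ "[(\<tau>, b)]"]) (auto simp: L_def letters_def)
    qed
  next
    case (mult g g')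
    then obtain z z' where z: "z \<in> lists L" "gcls (flat z) = g" "z' \<in> lists L" "gcls (flat z') = g'" by blast
    moreover from this have "z \<in> lists \<Gamma>" "z' \<in> lists \<Gamma>" using L_Gamma by auto
    ultimately show ?case using gcls_append[OF flat_Gamma flat_Gamma, of z z']
      by (intro bexI[of _ "z @ z'"]) auto
  qed
  have words_P: "gcls (flat z) \<in> P" if "z \<in> lists L" for z
    using that
  proof (induction z)
    case Nil
    have "\<one>\<^bsub>G\<^esub> \<in> P" unfolding P by (rule mon_generate.one)
    then show ?case by (simp add: HNN_def gp_one)
  next
    case (Cons c z)
    then have c: "c \<in> L" "z \<in> lists L" "z \<in> lists \<Gamma>" "c \<in> \<Gamma>" using L_Gamma by auto
    have "gcl c \<in> P"
    proof (cases "c \<in> letters U \<and> cl c \<in> Q")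
      case True
      then have "gcl c = hnn_embed X R t A \<phi> (cl c)" using hnn_embed_class flat_U1 by metis
      then show ?thesis unfolding P using True by (intro mon_generate.incl) auto
    next
      case False
      then obtain b where "c = (\<tau>, b)" using c(1) by (auto simp: L_def letters_def)
      then have "flat [c] = [(t, b)]"
        by (cases b) (simp_all add: flat_letter \<tau>_def inv_word_def inv_letter_def)
      then show ?thesis unfolding P by (cases b) (auto intro: mon_generate.incl)
    qed
    moreover have "gcls (flat (c # z)) = gcl c \<otimes>\<^bsub>G\<^esub> gcls (flat z)"
      using c flat_letter_words[OF _ Gamma_words] flat_Gamma by (subst flat_Cons, intro gcls_append)
    ultimately show ?case using Cons c unfolding P by (simp add: mon_generate.mult)
  qed
  have iff: "gcls w \<in> P \<longleftrightarrow> act (expands w) [] \<in> lists L" if w: "w \<in> words (insert t X)" for w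
  proof
    assume "gcls w \<in> P"
    then obtain z where z: "z \<in> lists L" "gcls (flat z) = gcls w" using P_words by blast
    then have "z \<in> lists \<Gamma>" using L_Gamma by auto
    \<comment> \<open>Being equal in the group, \<open>w\<close> and the word \<open>z\<close> over
      \<open>L\<close> have the same normal form, and the rules keep that of \<open>z\<close> over
      \<open>L\<close>.\<close>
    have "gp_eq (insert t X) (hnn_relations R t A \<phi>) w (flat z)"
      using gcls_eq_iff[OF w, of "flat z"] z(2) by simp
    then have "act (expands w) [] = act z []"
      using act_expands_cong[of w "flat z" "[]"] act_expands_flat[OF \<open>z \<in> lists \<Gamma>\<close>, of "[]"] by simp
    then show "act (expands w) [] \<in> lists L" using fold_push_lists[of L z "[]"] pass_L z(1) by simp
  next
    assume nf: "act (expands w) [] \<in> lists L"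
    have w': "expands w \<in> lists \<Gamma>" "gcls (flat (expands w)) = gcls w" using expands_Gamma[OF w] by auto
    have "gcls (flat (rev [])) = \<one>\<^bsub>G\<^esub>" by (simp add: HNN_def gp_one)
    \<comment> \<open>Conversely, the normal form read from the bottom of the stack represents the
      same element as \<open>w\<close> and exhibits it as a product of elements of
      \<open>P\<close>.\<close>
    then have "gcls (flat (rev (act (expands w) []))) = gcls w"
      using gcls_act[OF w'(1), of "[]"] w'(2) gcls_closed[OF w] by simp
    moreover have "rev (act (expands w) []) \<in> lists L" using nf by (simp add: in_lists_conv_set)
    ultimately show "gcls w \<in> P" using words_P by metis
  qed
  have "decidable_language (letters (insert t X)) {w \<in> words (insert t X). act (expands w) [] \<in> lists L}"
  proof (rule decidable_language_normal_form[OF _ _ L_Gamma])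
    show "finite (letters (insert t X))" "finite \<Gamma>"
      using finite_X finite_U by (simp_all add: letters_def)
    show "expand l \<in> lists \<Gamma>" if "l \<in> letters (insert t X)" for l
      using expand_Gamma[OF that] by blast
  qed (rule pass_Gamma)
  moreover have "{w \<in> words (insert t X). act (expands w) [] \<in> lists L} = {w \<in> words (insert t X). gcls w \<in> P}"
    using iff by blast
  ultimately show ?thesis by (simp add: decidable_membership_def)
qed

end

theorem theorem4p2:
  fixes X :: "'x set" and R :: "('x word \<times> 'x word) set" and t :: 'x
    and U_H U_A U_B U_Q :: "'x word set"
    and A B Q P :: "'x word set set" and \<phi> :: "'x word set \<Rightarrow> 'x word set"
    and H H_star :: "'x word set monoid"
  assumes "finite X" and "finite R" and "R \<subseteq> words X \<times> words X"
    and "H = Gp X R"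
    and "free_basis_words X R U_H"
    and "subgroup A H" and "subgroup B H"
    and "\<phi> \<in> iso (H\<lparr>carrier := A\<rparr>) (H\<lparr>carrier := B\<rparr>)"
    and "t \<notin> X"
    and "H_star = HNN X R t A \<phi>"
    and "U_A \<subseteq> bar U_H" and "U_B \<subseteq> bar U_H"
    and "A = generate H (gp_class X R ` U_A)"
    and "B = generate H (gp_class X R ` U_B)"
    and "\<phi> ` gp_class X R ` bar U_A = gp_class X R ` bar U_B"
    and "U_Q \<subseteq> bar U_H"
    and "Q = mon_generate H (gp_class X R ` U_Q)"
    and "\<phi> ` (Q \<inter> A) = Q \<inter> B"
    and "P = mon_generate H_star
               (hnn_embed X R t A \<phi> ` Q \<union>
                {hnn_class X R t A \<phi> [(t, True)], hnn_class X R t A \<phi> [(t, False)]})"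
  shows "decidable_membership (insert t X) (hnn_relations R t A \<phi>) P"
proof -
  interpret free_hnn X R t U_H U_A U_B A B \<phi>
    using assms by unfold_locales simp_all
  show ?thesis
    using assms(16-19) unfolding assms(4,10) by (rule decidable_monoid)
qed

end
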